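(* Fix $\rho,r_c,r_s>0$ and write $B_c=B_c(r_c)$, $B_s=B_s(r_s)$. Define $$U=\{(\mathrm{x}_c,\mathrm{x}_s)\in B_c\times B_s:\ \rho\|\mathrm{x}_s\|_{\ell^1}<\mathrm{dist}(\mathrm{x}_c,\partial B_c)\},$$ where $\partial B_c$ denotes the boundary of $B_c$ (in $X_c\cong\mathbb{C}$). Let $$\delta_1=2r_c+(1+2\rho)r_s,\quad \delta_2=2r_c+2(1+\rho)r_s,\quad \delta_3=2\left(\rho(r_c+\rho r_s)+r_s\right),\quad \delta_4=2(r_c+2\rho r_s+r_s),$$ $$\lambda=\frac{2\left(\rho(r_c+\rho r_s)+r_s\right)2r_s}{(\mu-\delta_1)(\mu-\delta_4)}+\frac{2(r_c+\rho r_s)}{\mu-\delta_1},$$ and suppose that $\delta_1,\delta_2,\delta_4<\mu$, $\frac{\delta_3}{\mu-\delta_2}<\rho$ and $\lambda<1$, and that there exists some $\alpha\in\mathcal{B}$ such that $\Psi[\alpha]=\alpha$. Then $U$ is contained in the $\alpha$-skew image of $B_c\times B_s$, that is, $$U\subseteq\{(\alpha(\mathrm{x}_c,\mathrm{x}_s),\mathrm{x}_s):(\mathrm{x}_c,\mathrm{x}_s)\in B_c\times B_s\}.$$ Furthermore, for all $a(0)\in U$, the solution $a(t)$ of $$\dot a_k=e^{\mathrm{i}\theta}\Big[-k^2\omega^2a_k+\sum_{k_1+k_2=k}a_{k_1}a_{k_2}\Big]\quad(k\in\mathbb{Z})$$ with initial value $a(0)$ satisfies $\lim_{t\to\infty}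a(t)=0$.
   Context: Fix $\theta\in(-\pi/2,\pi/2)$, $\omega=2\pi$ and $\mu=\omega^2\cos\theta$. $\ell^1$ is the space of complex sequences $a=(a_k)_{k\in\mathbb{Z}}$ with $\|a\|_{\ell^1}=\sum_k|a_k|<\infty$. The differential equation in the claim is considered in $\ell^1$. Let $X_c=\{a\in\ell^1:a_k=0\ \forall k\ne0\}$ (identified with $\mathbb{C}$) and $X_s=\{a\in\ell^1:a_0=0\}$. Writing $a=(\mathrm{x}_c,\mathrm{x}_s)\in X_c\times X_s$, the equation becomes $\dot{\mathrm{x}}_c=\mathcal{N}_c(\mathrm{x}_c,\mathrm{x}_s)$, $\dot{\mathrm{x}}_s=\mathfrak{L}\mathrm{x}_s+\mathcal{N}_s(\mathrm{x}_c,\mathrm{x}_s)$, where $$(\mathfrak{L}a)_k=-e^{\mathrm{i}\theta}k^2\omega^2a_k,\qquad \mathcal{N}_c(\mathrm{x}_c,\mathrm{x}_s)=e^{\mathrm{i}\theta}\sum_{k\in\mathbb{Z}}a_ka_{-k},\qquad (\mathcal{N}_s(\mathrm{x}_c,\mathrm{x}_s))_k=e^{\mathrm{i}\theta}\sum_{k_1+k_2=k}a_{k_1}a_{k_2}\ (k\neq0).$$ For $\phi\in\mathbb{C}$ let $\Phi(t,\phi)=\dfrac{\phi}{1-\phi te^{\mathrm{i}\theta}}$, the solution of $\dot{\mathrm{x}}_c=e^{\mathrm{i}\theta}\mathrm{x}_c^2$ with $\mathrm{x}_c(0)=\phi$. For $r_c,r_s>0$ let $$B_c(r_c)=\{\mathrm{x}_c\in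 X_c:|\mathrm{x}_c|\le r_c,\ \mathrm{Re}(e^{\mathrm{i}\theta}\mathrm{x}_c)\le0\},\qquad B_s(r_s)=\{\mathrm{x}_s\in X_s:\|\mathrm{x}_s\|_{\ell^1}\le r_s\}.$$ For fixed $\rho>0$, $\mathcal{B}$ is the set of Lipschitz maps $\alpha:B_c(r_c)\times B_s(r_s)\to X_c$ (with some Lipschitz constant) such that $\alpha(\mathrm{x}_c,0)=\mathrm{x}_c$ and $|\alpha(\mathrm{x}_c,\mathrm{x}_1)-\alpha(\mathrm{x}_c,\mathrm{x}_2)|\le\rho\|\mathrm{x}_1-\mathrm{x}_2\|_{\ell^1}$ for all $\mathrm{x}_c\in B_c(r_c)$, $\mathrm{x}_1,\mathrm{x}_2\in B_s(r_s)$. For $\alpha\in\mathcal{B}$, $\phi\in B_c(r_c)$, $\xi\in B_s(r_s)$, let $x(t,\phi,\xi,\alpha)\in X_s$ be the (mild, i.e. variation-of-constants) solution of $$\dot{\mathrm{x}}_s=\mathfrak{L}\mathrm{x}_s+\mathcal{N}_s\left(\alpha(\Phi(t,\phi),\mathrm{x}_s),\mathrm{x}_s\right),\qquad \mathrm{x}_s(0)=\xi .$$ The Lyapunov-Perron operator is $$\Psi[\alpha](\phi,\xi)=-\int_0^\infty\mathcal{N}_c\left(\alpha\big(\Phi(t,\phi),x(t,\phi,\xi,\alpha)\big),x(t,\phi,\xi,\alpha)\right)dt .$$ *)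

theory Defs
  imports "HOL-Analysis.Analysis"
begin

typedef ell1 = "{a :: int \<Rightarrow> complex. (\<lambda>k. norm (a k)) summable_on UNIV}"
  morphisms coord Abs_ell1
  by (rule exI[of _ "\<lambda>_. 0"]) simp

setup_lifting type_definition_ell1

lemma coord_summable: "(\<lambda>k. norm (coord a k)) summable_on UNIV"
  using coord[of a] by simp

lemma ell1_eqI: "(\<And>k. coord a k = coord b k) \<Longrightarrow> a = b"
  by (metis coord_inject ext)

lemma summable_norm_add:
  fixes a b :: "int \<Rightarrow> complex"
  assumes "(\<lambda>k. norm (a k)) summable_on UNIV" "(\<lambda>k. norm (b k)) summable_on UNIV"
  shows "(\<lambda>k. norm (a k + b k)) summable_on UNIV"
  using summable_on_add[OF assms]
  by (rule summable_on_comparison_test) (auto intro: norm_triangle_ineq)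

instantiation ell1 :: real_normed_vector
begin

lift_definition zero_ell1 :: ell1 is "\<lambda>_. 0" by simp
lift_definition plus_ell1 :: "ell1 \<Rightarrow> ell1 \<Rightarrow> ell1" is "\<lambda>a b k. a k + b k"
  by (rule summable_norm_add)
lift_definition uminus_ell1 :: "ell1 \<Rightarrow> ell1" is "\<lambda>a k. - a k" by simp
lift_definition minus_ell1 :: "ell1 \<Rightarrow> ell1 \<Rightarrow> ell1" is "\<lambda>a b k. a k - b k"
  using summable_norm_add[of _ "\<lambda>k. - _ k"] by simp
lift_definition scaleR_ell1 :: "real \<Rightarrow> ell1 \<Rightarrow> ell1" is "\<lambda>r a k. r *\<^sub>R a k"
  by (simp add: summable_on_cmult_right)
lift_definition norm_ell1 :: "ell1 \<Rightarrow> real" is "\<lambda>a. \<Sum>\<^sub>\<infinity>k. norm (a k)" .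

definition dist_ell1 :: "ell1 \<Rightarrow> ell1 \<Rightarrow> real" where "dist_ell1 a b = norm (a - b)"
definition sgn_ell1 :: "ell1 \<Rightarrow> ell1" where "sgn_ell1 a = inverse (norm a) *\<^sub>R a"
definition uniformity_ell1 :: "(ell1 \<times> ell1) filter" where
  "uniformity_ell1 = (INF e\<in>{0<..}. principal {(x, y). dist x y < e})"
definition open_ell1 :: "ell1 set \<Rightarrow> bool" where
  "open_ell1 U = (\<forall>x\<in>U. \<forall>\<^sub>F (x', y) in uniformity. x' = x \<longrightarrow> y \<in> U)"

instance
proof
  fix a b c :: ell1 and r s :: real
  show "a + b + c = a + (b + c)" by transfer (simp add: add.assoc)
  show "a + b = b + a" by transfer (simp add: add.commute)
  show "0 + a = a" by transfer simp
  show "- a + a = 0" by transfer simp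
  show "a - b = a + - b" by transfer simp
  show "r *\<^sub>R (a + b) = r *\<^sub>R a + r *\<^sub>R b" by transfer (simp add: scaleR_add_right)
  show "(r + s) *\<^sub>R a = r *\<^sub>R a + s *\<^sub>R a" by transfer (simp add: scaleR_add_left)
  show "r *\<^sub>R s *\<^sub>R a = (r * s) *\<^sub>R a" by transfer simp
  show "1 *\<^sub>R a = a" by transfer simp
  show "dist a b = norm (a - b)" by (rule dist_ell1_def)
  show "sgn a = inverse (norm a) *\<^sub>R a" by (rule sgn_ell1_def)
  show "uniformity = (INF e\<in>{0<..}. principal {(x, y :: ell1). dist x y < e})"
    by (rule uniformity_ell1_def)
  show "open U \<longleftrightarrow> (\<forall>x\<in>U. \<forall>\<^sub>F (x', y) in uniformity. x' = x \<longrightarrow> y \<in> U)" for U :: "ell1 set"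
    by (rule open_ell1_def)
  show "norm a = 0 \<longleftrightarrow> a = 0"
  proof transfer
    fix a :: "int \<Rightarrow> complex" assume a: "(\<lambda>k. norm (a k)) summable_on UNIV"
    show "(\<Sum>\<^sub>\<infinity>k. norm (a k)) = 0 \<longleftrightarrow> a = (\<lambda>_. 0)"
    proof
      assume "(\<Sum>\<^sub>\<infinity>k. norm (a k)) = 0"
      then have "norm (a k) = 0" for k
        by (intro nonneg_infsum_le_0D[of "\<lambda>k. norm (a k)" UNIV k]) (simp_all add: a)
      then show "a = (\<lambda>_. 0)" by (simp add: fun_eq_iff)
    qed simp
  qed
  show "norm (r *\<^sub>R a) = \<bar>r\<bar> * norm a"
    by transfer (simp only: norm_scaleR infsum_cmult_right')
  show "norm (a + b) \<le> norm a + norm b"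
  proof transfer
    fix a b :: "int \<Rightarrow> complex"
    assume a: "(\<lambda>k. norm (a k)) summable_on UNIV" and b: "(\<lambda>k. norm (b k)) summable_on UNIV"
    show "(\<Sum>\<^sub>\<infinity>k. norm (a k + b k)) \<le> (\<Sum>\<^sub>\<infinity>k. norm (a k)) + (\<Sum>\<^sub>\<infinity>k. norm (b k))"
      unfolding infsum_add[OF a b, symmetric]
      by (rule infsum_mono[OF summable_norm_add[OF a b] summable_on_add[OF a b] norm_triangle_ineq])
  qed
qed

end

lemma norm_ell1_eq: "norm a = (\<Sum>\<^sub>\<infinity>k. norm (coord a k))"
  by transfer simp

lemma sum_norm_coord_le: "finite F \<Longrightarrow> (\<Sum>k\<in>F. norm (coord a k)) \<le> norm a"
  unfolding norm_ell1_eq by (rule finite_sum_le_infsum[OF coord_summable]) auto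

lemma norm_coord_le: "norm (coord a k) \<le> norm a"
  using sum_norm_coord_le[of "{k}"] by simp

lemma coord_simps [simp]:
  "coord 0 k = 0" "coord (a + b) k = coord a k + coord b k" "coord (- a) k = - coord a k"
  "coord (a - b) k = coord a k - coord b k" "coord (r *\<^sub>R a) k = r *\<^sub>R coord a k"
  by (transfer; simp)+

lemma ell1_boundedI:
  assumes "\<And>F. finite F \<Longrightarrow> (\<Sum>k\<in>F. norm (f k)) \<le> C"
  shows "(\<lambda>k. norm (f k :: complex)) summable_on (UNIV :: int set)"
    and "norm (Abs_ell1 f) \<le> C"
proof -
  show s: "(\<lambda>k. norm (f k :: complex)) summable_on (UNIV :: int set)"
    by (rule nonneg_bdd_above_summable_on) (use assms in \<open>auto intro!: bdd_aboveI2\<close>)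
  show "norm (Abs_ell1 f) \<le> C"
    using s by (simp add: norm_ell1_eq Abs_ell1_inverse infsum_le_finite_sums assms)
qed

instance ell1 :: banach
proof
  fix X :: "nat \<Rightarrow> ell1" assume X: "Cauchy X"
  have "Cauchy (\<lambda>n. coord (X n) k)" for k
  proof (rule CauchyI)
    fix e :: real assume "0 < e"
    then obtain M where M: "\<forall>m\<ge>M. \<forall>n\<ge>M. norm (X m - X n) < e"
      using CauchyD[OF X] by blast
    have "norm (coord (X m) k - coord (X n) k) \<le> norm (X m - X n)" for m n
      using norm_coord_le[of "X m - X n" k] by simp
    with M show "\<exists>M. \<forall>m\<ge>M. \<forall>n\<ge>M. norm (coord (X m) k - coord (X n) k) < e"
      by (meson le_less_trans)
  qed
  then have "\<exists>l. (\<lambda>n. coord (X n) k) \<longlonglongrightarrow> l" for k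
    using Cauchy_convergent convergent_def by blast
  then obtain b where b: "\<And>k. (\<lambda>n. coord (X n) k) \<longlonglongrightarrow> b k"
    by metis
  have bound: "(\<Sum>k\<in>F. norm (b k - coord (X m) k)) \<le> e"
    if "finite F" and M: "\<forall>m\<ge>M. \<forall>n\<ge>M. norm (X m - X n) < e" and m: "m \<ge> M" for F M m e
  proof (rule LIMSEQ_le_const2)
    show "(\<lambda>n. \<Sum>k\<in>F. norm (coord (X n) k - coord (X m) k)) \<longlonglongrightarrow> (\<Sum>k\<in>F. norm (b k - coord (X m) k))"
      by (intro tendsto_intros b)
    have "(\<Sum>k\<in>F. norm (coord (X n) k - coord (X m) k)) \<le> e" if "n \<ge> M" for n
      using sum_norm_coord_le[OF \<open>finite F\<close>, of "X n - X m"] M m that by force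
    then show "\<exists>N. \<forall>n\<ge>N. (\<Sum>k\<in>F. norm (coord (X n) k - coord (X m) k)) \<le> e"
      by blast
  qed
  have bs: "(\<lambda>k. norm (b k)) summable_on UNIV"
  proof -
    obtain M where M: "\<forall>m\<ge>M. \<forall>n\<ge>M. norm (X m - X n) < 1"
      using CauchyD[OF X] zero_less_one by blast
    have "(\<lambda>k. norm (b k - coord (X M) k)) summable_on UNIV"
      by (rule ell1_boundedI(1)) (rule bound[OF _ M], auto)
    from summable_norm_add[OF this coord_summable[of "X M"]] show ?thesis by simp
  qed
  have cb: "coord (Abs_ell1 b) = b" using bs by (simp add: Abs_ell1_inverse)
  have "X \<longlonglongrightarrow> Abs_ell1 b"
  proof (rule LIMSEQ_I)
    fix e :: real assume "0 < e"
    then obtain M where M: "\<forall>m\<ge>M. \<forall>n\<ge>M. norm (X m - X n) < e / 2"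
      using CauchyD[OF X, of "e / 2"] by auto
    have "norm (X m - Abs_ell1 b) < e" if "m \<ge> M" for m
    proof -
      have "coord (Abs_ell1 b - X m) = (\<lambda>k. b k - coord (X m) k)" by (simp add: fun_eq_iff cb)
      then have "Abs_ell1 b - X m = Abs_ell1 (\<lambda>k. b k - coord (X m) k)"
        by (metis coord_inverse)
      moreover have "norm (Abs_ell1 (\<lambda>k. b k - coord (X m) k)) \<le> e / 2"
        by (rule ell1_boundedI(2)) (rule bound[OF _ M that])
      ultimately show ?thesis using \<open>0 < e\<close> by (simp add: norm_minus_commute)
    qed
    then show "\<exists>M. \<forall>m\<ge>M. norm (X m - Abs_ell1 b) < e" by blast
  qed
  then show "convergent X" by (rule convergentI)
qed


lemma summable_norm_conv:
  fixes a b :: "int \<Rightarrow> complex"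
  assumes a: "(\<lambda>k. norm (a k)) summable_on UNIV" and b: "(\<lambda>k. norm (b k)) summable_on UNIV"
  shows "(\<lambda>k. norm (\<Sum>\<^sub>\<infinity>(k1, k2)\<in>{(k1, k2). k1 + k2 = k}. a k1 * b k2)) summable_on UNIV"
proof -
  let ?D = "\<lambda>k :: int. {(k1, k2). k1 + k2 = k}"
  have prod: "(\<lambda>p. norm (a (fst p) * b (snd p))) summable_on UNIV \<times> UNIV"
    unfolding Infinite_Sum.abs_summable_on_Sigma_iff
  proof (intro conjI ballI)
    show "(\<lambda>y. norm (a (fst (x, y)) * b (snd (x, y)))) summable_on UNIV" for x
      unfolding fst_conv snd_conv norm_mult by (rule summable_on_cmult_right[OF b])
    have "norm (\<Sum>\<^sub>\<infinity>y. norm (a (fst (x, y)) * b (snd (x, y)))) = norm (a x) * (\<Sum>\<^sub>\<infinity>y. norm (b y))" for x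
      unfolding fst_conv snd_conv norm_mult infsum_cmult_right'
      by (simp only: abs_mult abs_norm_cancel real_norm_def abs_of_nonneg[OF infsum_nonneg] norm_ge_zero)
    then show "(\<lambda>x. norm (\<Sum>\<^sub>\<infinity>y. norm (a (fst (x, y)) * b (snd (x, y))))) summable_on UNIV"
      by (simp only: summable_on_cmult_left[OF a])
  qed
  have reindex: "(\<lambda>p. norm (a (fst p) * b (snd p))) summable_on UNIV \<times> UNIV \<longleftrightarrow>
      (\<lambda>q. norm (a (fst (snd q)) * b (snd (snd q)))) summable_on Sigma UNIV ?D"
    by (rule summable_on_reindex_bij_witness[of _ snd "\<lambda>p. (fst p + snd p, p)"]) auto
  have "(\<lambda>q. norm (a (fst (snd q)) * b (snd (snd q)))) summable_on Sigma UNIV ?D"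
    using prod unfolding reindex .
  then have 1: "(\<lambda>p. norm (a (fst p) * b (snd p))) summable_on ?D k"
    and 2: "(\<lambda>k. \<Sum>\<^sub>\<infinity>p\<in>?D k. norm (a (fst p) * b (snd p))) summable_on UNIV" for k
    unfolding Infinite_Sum.abs_summable_on_Sigma_iff by (auto simp: infsum_nonneg)
  have "(\<lambda>k. norm (\<Sum>\<^sub>\<infinity>p\<in>?D k. a (fst p) * b (snd p))) summable_on UNIV"
    by (rule Infinite_Sum.abs_summable_on_comparison_test'[OF 2]) (rule norm_infsum_bound[OF 1])
  then show "(\<lambda>k. norm (\<Sum>\<^sub>\<infinity>(k1, k2)\<in>?D k. a k1 * b k2)) summable_on UNIV"
    by (simp only: case_prod_unfold)
qed

lift_definition conv :: "ell1 \<Rightarrow> ell1 \<Rightarrow> ell1" is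
  "\<lambda>a b k. \<Sum>\<^sub>\<infinity>(k1, k2)\<in>{(k1, k2). k1 + k2 = k}. a k1 * b k2"
  by (rule summable_norm_conv)

text \<open>
  The centre space \<open>X\<^sub>c\<close> is identified with \<^typ>\<open>complex\<close>; \<open>X\<^sub>s\<close> is a subset of \<^typ>\<open>ell1\<close>.
  A pair in \<open>X\<^sub>c \<times> X\<^sub>s\<close> is assembled into a sequence by \<open>join\<close>.
\<close>

definition Xs :: "ell1 set" where
  "Xs = {a. coord a 0 = 0}"

lift_definition join :: "complex \<Rightarrow> ell1 \<Rightarrow> ell1" is
  "\<lambda>xc xs k. if k = 0 then xc else xs k"
proof -
  fix xc :: complex and xs :: "int \<Rightarrow> complex"
  assume xs: "(\<lambda>k. norm (xs k)) summable_on UNIV"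
  have "(\<lambda>k. norm (if k = 0 then xc else 0)) summable_on {0 :: int}"
    by simp
  then have "(\<lambda>k :: int. norm (if k = 0 then xc else 0)) summable_on UNIV"
    by (rule summable_on_cong_neutral[THEN iffD1, rotated -1]) auto
  from summable_on_add[OF this xs]
  show "(\<lambda>k. norm (if k = 0 then xc else xs k)) summable_on UNIV"
    by (rule Infinite_Sum.abs_summable_on_comparison_test') auto
qed


definition \<omega> :: real where
  "\<omega> = 2 * pi"

definition \<mu> :: "real \<Rightarrow> real" where
  "\<mu> \<theta> = \<omega>\<^sup>2 * cos \<theta>"

text \<open>
  The full equation: \<open>a\<close> is a continuous curve in \<open>\<ell>\<^sup>1\<close> on \<open>[0, \<infinity>)\<close> along which every Fourier
  coefficient satisfies its equation (with a one-sided derivative at \<open>t = 0\<close>).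
\<close>

definition is_solution :: "real \<Rightarrow> ell1 \<Rightarrow> (real \<Rightarrow> ell1) \<Rightarrow> bool" where
  "is_solution \<theta> a0 a \<longleftrightarrow>
     continuous_on {0..} a \<and> a 0 = a0 \<and>
     (\<forall>t\<ge>0. \<forall>k. ((\<lambda>t. coord (a t) k) has_vector_derivative
        cis \<theta> * (- of_real ((real_of_int k)\<^sup>2 * \<omega>\<^sup>2) * coord (a t) k + coord (conv (a t) (a t)) k))
        (at t within {0..}))"

text \<open>
  \<open>semigroup \<theta> t\<close> is the operator \<open>exp (t \<LL>)\<close>, for the unbounded diagonal operator \<open>\<LL>\<close> with
  eigenvalues \<open>- e\<^bsup>i\<theta>\<^esup> k\<^sup>2 \<omega>\<^sup>2\<close>. It maps \<open>\<ell>\<^sup>1\<close> to \<open>\<ell>\<^sup>1\<close> when \<open>t \<ge> 0\<close> and \<open>cos \<theta> \<ge> 0\<close>, and is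
  only used for such arguments.
\<close>

definition semigroup :: "real \<Rightarrow> real \<Rightarrow> ell1 \<Rightarrow> ell1" where
  "semigroup \<theta> t a =
     Abs_ell1 (\<lambda>k. exp (of_real t * (- cis \<theta> * of_real ((real_of_int k)\<^sup>2 * \<omega>\<^sup>2))) * coord a k)"

lemma coord_semigroup:
  assumes "t \<ge> 0" and "cos \<theta> \<ge> 0"
  shows "coord (semigroup \<theta> t a) k =
    exp (of_real t * (- cis \<theta> * of_real ((real_of_int k)\<^sup>2 * \<omega>\<^sup>2))) * coord a k"
proof -
  have "norm (exp (of_real t * (- cis \<theta> * of_real ((real_of_int k)\<^sup>2 * \<omega>\<^sup>2))) * coord a k)
      \<le> norm (coord a k)" for k
  proof -
    have "t * (cos \<theta> * ((real_of_int k)\<^sup>2 * \<omega>\<^sup>2)) \<ge> 0"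
      using assms by (intro mult_nonneg_nonneg) auto
    then have "exp (- (t * (cos \<theta> * ((real_of_int k)\<^sup>2 * \<omega>\<^sup>2)))) * norm (coord a k) \<le> norm (coord a k)"
      by (intro mult_left_le_one_le) auto
    moreover have "Re (of_real t * (- cis \<theta> * of_real ((real_of_int k)\<^sup>2 * \<omega>\<^sup>2)))
        = - (t * (cos \<theta> * ((real_of_int k)\<^sup>2 * \<omega>\<^sup>2)))"
      by (simp only: Re_complex_of_real Im_complex_of_real times_complex.sel uminus_complex.sel cis.sel) simp
    ultimately show ?thesis by (simp only: norm_mult norm_exp_eq_Re)
  qed
  then have "(\<lambda>k. norm (exp (of_real t * (- cis \<theta> * of_real ((real_of_int k)\<^sup>2 * \<omega>\<^sup>2))) * coord a k))
      summable_on UNIV"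
    by (rule Infinite_Sum.abs_summable_on_comparison_test'[OF coord_summable[of a]])
  then show ?thesis
    unfolding semigroup_def by (simp only: Abs_ell1_inverse mem_Collect_eq)
qed

definition Nc :: "real \<Rightarrow> complex \<Rightarrow> ell1 \<Rightarrow> complex" where
  "Nc \<theta> xc xs = cis \<theta> * (\<Sum>\<^sub>\<infinity>k. coord (join xc xs) k * coord (join xc xs) (- k))"

lift_definition cscale :: "complex \<Rightarrow> ell1 \<Rightarrow> ell1" is "\<lambda>c a k. c * a k"
  by (simp add: norm_mult summable_on_cmult_right)

text \<open>Joining with \<open>0\<close> projects to \<open>X\<^sub>s\<close>, i.e. removes the coefficient at \<open>k = 0\<close>.\<close>

definition Ns :: "real \<Rightarrow> complex \<Rightarrow> ell1 \<Rightarrow> ell1" where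
  "Ns \<theta> xc xs = join 0 (cscale (cis \<theta>) (conv (join xc xs) (join xc xs)))"

definition \<Phi> :: "real \<Rightarrow> real \<Rightarrow> complex \<Rightarrow> complex" where
  "\<Phi> \<theta> t \<phi> = \<phi> / (1 - \<phi> * of_real t * cis \<theta>)"

definition Bc :: "real \<Rightarrow> real \<Rightarrow> complex set" where
  "Bc \<theta> rc = {xc. norm xc \<le> rc \<and> Re (cis \<theta> * xc) \<le> 0}"

definition Bs :: "real \<Rightarrow> ell1 set" where
  "Bs rs = {xs \<in> Xs. norm xs \<le> rs}"


text \<open>
  The maps \<open>\<alpha>\<close> are partial, with domain \<open>B\<^sub>c \<times> B\<^sub>s\<close>: values elsewhere are unconstrained and never used.
\<close>

definition LP_space ::
    "real \<Rightarrow> real \<Rightarrow> real \<Rightarrow> real \<Rightarrow> (complex \<Rightarrow> ell1 \<Rightarrow> complex) set" where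
  "LP_space \<theta> \<rho> rc rs = {\<alpha>.
     (\<exists>L. L-lipschitz_on (Bc \<theta> rc \<times> Bs rs) (\<lambda>(xc, xs). \<alpha> xc xs)) \<and>
     (\<forall>xc\<in>Bc \<theta> rc. \<alpha> xc 0 = xc) \<and>
     (\<forall>xc\<in>Bc \<theta> rc. \<forall>x1\<in>Bs rs. \<forall>x2\<in>Bs rs. norm (\<alpha> xc x1 - \<alpha> xc x2) \<le> \<rho> * norm (x1 - x2))}"

text \<open>
  Mild (variation-of-constants) solutions on \<open>[0, \<infinity>)\<close> of
  \<open>x' = \<LL> x + N\<^sub>s (\<alpha> (\<Phi> t \<phi>) x) x\<close>, \<open>x 0 = \<xi>\<close>. They must stay in \<open>B\<^sub>s\<close>, where \<open>\<alpha>\<close> is defined.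
\<close>

definition mild_solution ::
    "real \<Rightarrow> real \<Rightarrow> (complex \<Rightarrow> ell1 \<Rightarrow> complex) \<Rightarrow> complex \<Rightarrow> ell1 \<Rightarrow> (real \<Rightarrow> ell1) \<Rightarrow> bool" where
  "mild_solution \<theta> rs \<alpha> \<phi> \<xi> x \<longleftrightarrow>
     continuous_on {0..} x \<and> (\<forall>t\<ge>0. x t \<in> Bs rs) \<and>
     (\<forall>t\<ge>0. ((\<lambda>s. semigroup \<theta> (t - s) (Ns \<theta> (\<alpha> (\<Phi> \<theta> s \<phi>) (x s)) (x s)))
        has_integral (x t - semigroup \<theta> t \<xi>)) {0..t})"

text \<open>
  The mild solution is unique on \<open>[0, \<infinity>)\<close>; its values at negative times are arbitrary and
  never used.
\<close>

definition xflow ::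
    "real \<Rightarrow> real \<Rightarrow> (complex \<Rightarrow> ell1 \<Rightarrow> complex) \<Rightarrow> complex \<Rightarrow> ell1 \<Rightarrow> real \<Rightarrow> ell1" where
  "xflow \<theta> rs \<alpha> \<phi> \<xi> = (SOME x. mild_solution \<theta> rs \<alpha> \<phi> \<xi> x)"

definition \<Psi> ::
    "real \<Rightarrow> real \<Rightarrow> (complex \<Rightarrow> ell1 \<Rightarrow> complex) \<Rightarrow> complex \<Rightarrow> ell1 \<Rightarrow> complex" where
  "\<Psi> \<theta> rs \<alpha> \<phi> \<xi> =
     - integral {0..} (\<lambda>t. Nc \<theta> (\<alpha> (\<Phi> \<theta> t \<phi>) (xflow \<theta> rs \<alpha> \<phi> \<xi> t)) (xflow \<theta> rs \<alpha> \<phi> \<xi> t))"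

definition Uset :: "real \<Rightarrow> real \<Rightarrow> real \<Rightarrow> real \<Rightarrow> (complex \<times> ell1) set" where
  "Uset \<theta> \<rho> rc rs =
     {(xc, xs) \<in> Bc \<theta> rc \<times> Bs rs. \<rho> * norm xs < infdist xc (frontier (Bc \<theta> rc))}"

end

theory Submission
  imports Defs
begin

text \<open>
  Let \<open>\<alpha>\<close> be a fixed point of the Lyapunov-Perron operator, \<open>\<phi> \<in> B\<^sub>c\<close> and \<open>\<xi> \<in> B\<^sub>s\<close>. Let \<open>x\<close> be the mild
  solution of the stable equation started at \<open>\<xi>\<close> and driven by the centre component
  \<open>y t = \<alpha> (\<Phi> t \<phi>) (x t)\<close>. As \<open>\<Phi>\<close> and \<open>x\<close> have the flow property, the fixed point equation at the point
  \<open>(\<Phi> t \<phi>, x t)\<close> says that \<open>y t\<close> is minus the integral of \<open>N\<^sub>c (y s) (x s)\<close> over \<open>s \<ge> t\<close>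
  (\<open>centre_integral_equation\<close>). Hence \<open>y' = N\<^sub>c y x\<close>, and \<open>(y, x)\<close> is a solution of the full equation that
  starts at \<open>(\<alpha> \<phi> \<xi>, \<xi>)\<close>. It tends to \<open>0\<close>, because \<open>\<Phi> t \<phi>\<close> decays like \<open>1 / t\<close>, \<open>x\<close> decays exponentially
  and \<open>y\<close> differs from \<open>\<Phi>\<close> by at most \<open>\<rho> \<parallel>x\<parallel>\<close> (\<open>graph_solution\<close>).

  It remains to write a given point \<open>(xc, xs)\<close> of \<open>U\<close> in the form \<open>(\<alpha> \<phi> xs, xs)\<close>. This is Brouwer's theorem for
  \<open>\<phi> \<mapsto> xc + (\<phi> - \<alpha> \<phi> xs)\<close> on the disc of radius \<open>\<rho> \<parallel>xs\<parallel>\<close> around \<open>xc\<close>, which lies in \<open>B\<^sub>c\<close> by the definition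
  of \<open>U\<close> (\<open>alpha_hits\<close>).

  The mild solutions exist globally since the linear part damps \<open>X\<^sub>s\<close> at rate \<open>\<mu>\<close> while the nonlinear forcing
  has relative size at most \<open>\<delta>\<^sub>1 < \<mu>\<close> and Lipschitz constant at most \<open>\<delta>\<^sub>4 < \<mu>\<close> on \<open>B\<^sub>s\<close>. The first inequality makes
  the curves with \<open>\<parallel>x t\<parallel> \<le> r\<^sub>s exp (- (\<mu> - \<delta>\<^sub>1) t)\<close> invariant under the Duhamel map, the second makes this map a
  contraction in the supremum norm (\<open>duhamel_fixed_point_exists\<close>). Uniqueness for the full equation uses that
  convolution is locally Lipschitz on \<open>\<ell>\<^sup>1\<close> (\<open>is_solution_unique\<close>).
\<close>

section \<open>The convolution algebra and the nonlinear terms\<close>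

lemma norm_ell1_leI:
  assumes "\<And>F. finite F \<Longrightarrow> (\<Sum>k\<in>F. norm (coord a k)) \<le> C"
  shows "norm a \<le> C"
  using ell1_boundedI(2)[OF assms] by (simp add: coord_inverse)

lemma norm_ell1_mono:
  assumes "\<And>k. norm (coord a k) \<le> c * norm (coord b k)"
  shows "norm a \<le> c * norm b"
proof -
  have "norm a \<le> (\<Sum>\<^sub>\<infinity>k. c * norm (coord b k))"
    unfolding norm_ell1_eq
    by (rule infsum_mono[OF coord_summable summable_on_cmult_right[OF coord_summable] assms])
  then show ?thesis
    by (simp add: infsum_cmult_right' norm_ell1_eq)
qed

lemma bounded_linear_coord: "bounded_linear (\<lambda>a. coord a k)"
  by (rule bounded_linear_intro[where K = 1]) (auto simp: norm_coord_le)

lemma coord_cscale [simp]: "coord (cscale c a) k = c * coord a k"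
  by transfer simp

lemma coord_join [simp]: "coord (join c a) k = (if k = 0 then c else coord a k)"
  by transfer simp

lemma coord_in_Xs: "a \<in> Xs \<Longrightarrow> coord a 0 = 0"
  by (simp add: Xs_def)

lemma norm_cscale: "norm (cscale c a) = norm c * norm a"
  by (simp add: norm_ell1_eq norm_mult infsum_cmult_right')

lemma norm_join_0_le: "norm (join 0 a) \<le> norm a"
  using norm_ell1_mono[of "join 0 a" 1 a] by simp

lemma join_0_in_Xs: "join 0 a \<in> Xs"
  by (simp add: Xs_def)

lemma norm_join_le: "norm (join c a) \<le> norm c + norm a"
proof (rule norm_ell1_leI)
  fix F :: "int set" assume F: "finite F"
  have "(\<Sum>k\<in>F. norm (coord (join c a) k)) \<le> (\<Sum>k\<in>F. (if k = 0 then norm c else 0) + norm (coord a k))"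
    by (rule sum_mono) auto
  also have "\<dots> \<le> norm c + norm a"
    using sum_norm_coord_le[OF F, of a] F by (simp add: sum.distrib sum.delta add_mono)
  finally show "(\<Sum>k\<in>F. norm (coord (join c a) k)) \<le> norm c + norm a" .
qed

lemma bounded_linear_join: "bounded_linear (\<lambda>(c, a). join c a)"
proof (rule bounded_linear_intro[where K = 2])
  fix p q :: "complex \<times> ell1" and r :: real
  show "(case p + q of (c, a) \<Rightarrow> join c a) = (case p of (c, a) \<Rightarrow> join c a) + (case q of (c, a) \<Rightarrow> join c a)"
    by (rule ell1_eqI) (simp split: prod.split)
  show "(case r *\<^sub>R p of (c, a) \<Rightarrow> join c a) = r *\<^sub>R (case p of (c, a) \<Rightarrow> join c a)"
    by (rule ell1_eqI) (simp split: prod.split)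
  have "norm (join (fst p) (snd p)) \<le> norm p * 2"
    using norm_join_le[of "fst p" "snd p"] norm_fst_le[of "fst p" "snd p"] norm_snd_le[of "snd p" "fst p"]
    by (simp add: add_mono)
  then show "norm (case p of (c, a) \<Rightarrow> join c a) \<le> norm p * 2"
    by (simp add: case_prod_unfold)
qed

lemma continuous_on_join [continuous_intros]:
  assumes "continuous_on S f" "continuous_on S g"
  shows "continuous_on S (\<lambda>t. join (f t) (g t))"
  using bounded_linear.continuous_on[OF bounded_linear_join continuous_on_Pair[OF assms]] by simp

lemma tendsto_join:
  assumes "(f \<longlongrightarrow> c) F" "(g \<longlongrightarrow> a) F"
  shows "((\<lambda>t. join (f t) (g t)) \<longlongrightarrow> join c a) F"
  using bounded_linear.tendsto[OF bounded_linear_join tendsto_Pair[OF assms]] by simp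

lemma bounded_bilinear_cscale: "bounded_bilinear cscale"
proof
  show "\<exists>K. \<forall>a b. norm (cscale a b) \<le> norm a * norm b * K"
    by (rule exI[of _ 1]) (simp add: norm_cscale)
qed (rule ell1_eqI; simp add: algebra_simps scaleR_conv_of_real)+

lemma coord_conv: "coord (conv a b) k = (\<Sum>\<^sub>\<infinity>j. coord a j * coord b (k - j))"
proof -
  have "coord (conv a b) k = (\<Sum>\<^sub>\<infinity>(k1, k2)\<in>{(k1, k2). k1 + k2 = k}. coord a k1 * coord b k2)"
    by transfer simp
  also have "\<dots> = (\<Sum>\<^sub>\<infinity>j. coord a j * coord b (k - j))"
    by (rule infsum_reindex_bij_witness[of _ "\<lambda>j. (j, k - j)" fst]) auto
  finally show ?thesis .
qed

lemma conv_terms_abs_summable: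
  "(\<lambda>j. norm (coord a j * coord b (k - j))) summable_on UNIV"
  by (rule Infinite_Sum.abs_summable_on_comparison_test'[OF summable_on_cmult_left[OF coord_summable, of a "norm b"]])
     (simp add: norm_mult mult_left_mono norm_coord_le)

lemmas conv_terms_summable = abs_summable_summable[OF conv_terms_abs_summable]

lemma has_sum_finite_sum:
  fixes f :: "'i \<Rightarrow> 'j \<Rightarrow> real"
  assumes "finite F" "\<And>k. k \<in> F \<Longrightarrow> f k summable_on A"
  shows "((\<lambda>j. \<Sum>k\<in>F. f k j) has_sum (\<Sum>k\<in>F. infsum (f k) A)) A"
  using assms by (induction F rule: finite_induct) (auto intro!: has_sum_add)

text \<open>
  Only finitely many output coefficients enter at a time, so the two summations can be interchanged
  without a double series; each column \<open>k \<mapsto> b (k - j)\<close> is a translate of \<open>b\<close> and sums to at most its norm.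
\<close>

lemma norm_conv_le: "norm (conv a b) \<le> norm a * norm b"
proof (rule norm_ell1_leI)
  fix F :: "int set" assume F: "finite F"
  have "(\<Sum>k\<in>F. norm (coord (conv a b) k)) \<le> (\<Sum>k\<in>F. \<Sum>\<^sub>\<infinity>j. norm (coord a j * coord b (k - j)))"
    unfolding coord_conv by (intro sum_mono norm_infsum_bound conv_terms_abs_summable)
  also have "\<dots> = (\<Sum>\<^sub>\<infinity>j. \<Sum>k\<in>F. norm (coord a j * coord b (k - j)))"
    by (rule infsumI[symmetric, OF has_sum_finite_sum[OF F conv_terms_abs_summable]])
  also have "\<dots> \<le> (\<Sum>\<^sub>\<infinity>j. norm (coord a j) * norm b)"
  proof (rule infsum_mono)
    show "(\<lambda>j. \<Sum>k\<in>F. norm (coord a j * coord b (k - j))) summable_on UNIV"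
      by (rule has_sum_imp_summable[OF has_sum_finite_sum[OF F conv_terms_abs_summable]])
    show "(\<lambda>j. norm (coord a j) * norm b) summable_on UNIV"
      by (rule summable_on_cmult_left[OF coord_summable])
    fix j
    have "(\<Sum>k\<in>F. norm (coord b (k - j))) = (\<Sum>k\<in>(\<lambda>k. k - j) ` F. norm (coord b k))"
      by (subst sum.reindex) (auto simp: inj_on_def)
    also have "\<dots> \<le> norm b"
      using F by (intro sum_norm_coord_le) auto
    finally show "(\<Sum>k\<in>F. norm (coord a j * coord b (k - j))) \<le> norm (coord a j) * norm b"
      by (simp add: norm_mult mult_left_mono flip: sum_distrib_left)
  qed
  also have "\<dots> = norm a * norm b"
    by (simp add: infsum_cmult_left' norm_ell1_eq)
  finally show "(\<Sum>k\<in>F. norm (coord (conv a b) k)) \<le> norm a * norm b" .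
qed

lemma bounded_bilinear_conv: "bounded_bilinear conv"
proof
  show "\<exists>K. \<forall>a b. norm (conv a b) \<le> norm a * norm b * K"
    by (rule exI[of _ 1]) (simp add: norm_conv_le)
  fix a a' b b' :: ell1 and r :: real
  show "conv (a + a') b = conv a b + conv a' b"
    by (rule ell1_eqI) (simp add: coord_conv distrib_right infsum_add conv_terms_summable)
  show "conv a (b + b') = conv a b + conv a b'"
    by (rule ell1_eqI) (simp add: coord_conv distrib_left infsum_add conv_terms_summable)
  show "conv (r *\<^sub>R a) b = r *\<^sub>R conv a b"
    by (rule ell1_eqI) (simp add: coord_conv infsum_cmult_right' scaleR_conv_of_real mult.assoc)
  show "conv a (r *\<^sub>R b) = r *\<^sub>R conv a b"
    by (rule ell1_eqI)
       (simp add: coord_conv infsum_cmult_right' scaleR_conv_of_real mult.left_commute[of _ "of_real r"])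
qed

lemma infsum_single: "(\<Sum>\<^sub>\<infinity>j. if j = i then f j else 0) = (f i :: complex)"
proof -
  have "(\<Sum>\<^sub>\<infinity>j. if j = i then f j else 0) = infsum f {i}"
    by (rule infsum_cong_neutral) auto
  then show ?thesis by simp
qed

lemma conv_join_0_left: "conv (join y 0) b = cscale y b"
proof (rule ell1_eqI)
  fix k
  have "coord (conv (join y 0) b) k = (\<Sum>\<^sub>\<infinity>j. if j = 0 then y * coord b (k - j) else 0)"
    unfolding coord_conv by (rule infsum_cong) simp
  then show "coord (conv (join y 0) b) k = coord (cscale y b) k"
    using infsum_single[of 0 "\<lambda>j. y * coord b (k - j)"] by simp
qed

lemma conv_join_0_right: "conv b (join y 0) = cscale y b"
proof (rule ell1_eqI)
  fix k
  have "coord (conv b (join y 0)) k = (\<Sum>\<^sub>\<infinity>j. if j = k then coord b j * y else 0)"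
    unfolding coord_conv by (rule infsum_cong) simp
  then show "coord (conv b (join y 0)) k = coord (cscale y b) k"
    using infsum_single[of k "\<lambda>j. coord b j * y"] by simp
qed

text \<open>
  Convolution with a sequence supported at \<open>0\<close> is multiplication by a scalar. Splitting off the
  centre component therefore leaves only the scalar terms and the stable-stable interaction
  \<open>conv x x\<close>, from which all bounds on the nonlinearities below are read off.
\<close>

lemma conv_join_self:
  assumes "x \<in> Xs"
  shows "conv (join y x) (join y x) = join (y\<^sup>2) 0 + cscale (2 * y) x + conv x x"
proof -
  have split: "join y x = join y 0 + x"
    by (rule ell1_eqI) (simp add: coord_in_Xs[OF assms])
  have "cscale y (join y 0) = join (y\<^sup>2) 0"
    by (rule ell1_eqI) (simp add: power2_eq_square)
  moreover have "cscale (2 * y) x = cscale y x + cscale y x"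
    by (rule ell1_eqI) simp
  ultimately show ?thesis
    unfolding split bounded_bilinear.add_left[OF bounded_bilinear_conv]
      bounded_bilinear.add_right[OF bounded_bilinear_conv] conv_join_0_left conv_join_0_right
      bounded_bilinear.add_right[OF bounded_bilinear_cscale]
    by (simp add: algebra_simps)
qed

lemma Ns_eq:
  assumes "x \<in> Xs"
  shows "Ns \<theta> y x = join 0 (cscale (cis \<theta>) (cscale (2 * y) x + conv x x))"
  unfolding Ns_def conv_join_self[OF assms] by (rule ell1_eqI) simp

lemma Nc_eq: "Nc \<theta> y x = cis \<theta> * coord (conv (join y x) (join y x)) 0"
  unfolding Nc_def coord_conv by simp

lemma norm_Nc_le:
  assumes "x \<in> Xs"
  shows "norm (Nc \<theta> y x) \<le> (norm y)\<^sup>2 + (norm x)\<^sup>2"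
proof -
  have "norm (coord (conv x x) 0) \<le> (norm x)\<^sup>2"
    using norm_coord_le[of "conv x x" 0] norm_conv_le[of x x] by (simp add: power2_eq_square)
  then show ?thesis
    unfolding Nc_eq conv_join_self[OF assms]
    using norm_triangle_ineq[of "y\<^sup>2" "coord (conv x x) 0"]
    by (simp add: coord_in_Xs[OF assms] norm_mult norm_power)
qed

lemma norm_Ns_le:
  assumes "x \<in> Xs"
  shows "norm (Ns \<theta> y x) \<le> (2 * norm y + norm x) * norm x"
proof -
  have "norm (Ns \<theta> y x) \<le> norm (cscale (cis \<theta>) (cscale (2 * y) x + conv x x))"
    unfolding Ns_eq[OF assms] by (rule norm_join_0_le)
  also have "\<dots> \<le> norm (cscale (2 * y) x) + norm (conv x x)"
    using norm_triangle_ineq[of "cscale (2 * y) x" "conv x x"] by (simp add: norm_cscale[of "cis \<theta>"])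
  also have "\<dots> \<le> (2 * norm y + norm x) * norm x"
    using norm_conv_le[of x x] by (simp add: norm_cscale norm_mult distrib_right)
  finally show ?thesis .
qed

text \<open>
  The differences of both quadratic terms are factored as \<open>u * v - u' * v' = (u - u') * v + u' * (v - v')\<close>.
  The two variables are kept separate because \<open>y\<close> is going to be a function of \<open>x\<close>.
\<close>

lemma norm_Ns_diff_le:
  assumes x: "x \<in> Xs" and x': "x' \<in> Xs"
  shows "norm (Ns \<theta> y x - Ns \<theta> y' x')
    \<le> (2 * norm y + norm x + norm x') * norm (x - x') + 2 * norm (y - y') * norm x'"
proof -
  interpret cs: bounded_bilinear cscale by (rule bounded_bilinear_cscale)
  interpret cv: bounded_bilinear conv by (rule bounded_bilinear_conv)
  let ?w = "cscale (2 * y) (x - x') + cscale (2 * (y - y')) x' + (conv (x - x') x + conv x' (x - x'))"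
  have "Ns \<theta> y x - Ns \<theta> y' x' = join 0 (cscale (cis \<theta>) ?w)"
    unfolding Ns_eq[OF x] Ns_eq[OF x'] cv.diff_left cv.diff_right
    by (rule ell1_eqI) (simp add: algebra_simps)
  then have "norm (Ns \<theta> y x - Ns \<theta> y' x') \<le> norm ?w"
    using norm_join_0_le[of "cscale (cis \<theta>) ?w"] by (simp add: norm_cscale)
  also have "\<dots> \<le> norm (cscale (2 * y) (x - x')) + norm (cscale (2 * (y - y')) x')
      + (norm (conv (x - x') x) + norm (conv x' (x - x')))"
    by (intro norm_triangle_le add_mono norm_triangle_ineq order_refl)
  also have "\<dots> \<le> 2 * norm y * norm (x - x') + 2 * norm (y - y') * norm x'
      + (norm (x - x') * norm x + norm x' * norm (x - x'))"
    by (intro add_mono norm_conv_le) (simp_all add: norm_cscale norm_mult del: right_diff_distrib_numeral)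
  finally show ?thesis by (simp add: algebra_simps)
qed

lemma Ns_in_Xs: "Ns \<theta> y x \<in> Xs"
  unfolding Ns_def by (rule join_0_in_Xs)

lemma continuous_on_conv [continuous_intros]:
  assumes "continuous_on S f" "continuous_on S g"
  shows "continuous_on S (\<lambda>t. conv (f t) (g t))"
  by (rule bounded_bilinear.continuous_on[OF bounded_bilinear_conv assms])

lemma continuous_on_cscale [continuous_intros]:
  assumes "continuous_on S f" "continuous_on S g"
  shows "continuous_on S (\<lambda>t. cscale (f t) (g t))"
  by (rule bounded_bilinear.continuous_on[OF bounded_bilinear_cscale assms])

lemma continuous_on_coord [continuous_intros]:
  "continuous_on S f \<Longrightarrow> continuous_on S (\<lambda>t. coord (f t) k)"
  by (rule bounded_linear.continuous_on[OF bounded_linear_coord])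

lemma continuous_on_Ns [continuous_intros]:
  assumes "continuous_on S f" "continuous_on S g"
  shows "continuous_on S (\<lambda>t. Ns \<theta> (f t) (g t))"
  unfolding Ns_def by (intro continuous_intros assms)

lemma continuous_on_Nc [continuous_intros]:
  assumes "continuous_on S f" "continuous_on S g"
  shows "continuous_on S (\<lambda>t. Nc \<theta> (f t) (g t))"
  unfolding Nc_eq by (intro continuous_intros assms)

section \<open>The linear semigroup\<close>

lemma mu_pos_iff_cos: "\<mu> \<theta> > 0 \<longleftrightarrow> cos \<theta> > 0"
  by (simp add: \<mu>_def \<omega>_def zero_less_mult_iff)

abbreviation eigenvalue :: "real \<Rightarrow> int \<Rightarrow> complex" where
  "eigenvalue \<theta> k \<equiv> - cis \<theta> * of_real ((real_of_int k)\<^sup>2 * \<omega>\<^sup>2)"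

lemma norm_exp_eigenvalue:
  "norm (exp (of_real t * eigenvalue \<theta> k)) = exp (- (\<mu> \<theta> * (real_of_int k)\<^sup>2 * t))"
proof -
  have "Re (of_real t * eigenvalue \<theta> k) = - (\<mu> \<theta> * (real_of_int k)\<^sup>2 * t)"
    unfolding \<mu>_def
    by (simp only: Re_complex_of_real Im_complex_of_real times_complex.sel uminus_complex.sel cis.sel) simp
  then show ?thesis by (simp only: norm_exp_eq_Re)
qed

lemma semigroup_add:
  assumes "s \<ge> 0" "t \<ge> 0" "cos \<theta> \<ge> 0"
  shows "semigroup \<theta> (s + t) a = semigroup \<theta> s (semigroup \<theta> t a)"
  using assms by (intro ell1_eqI) (simp add: coord_semigroup distrib_right exp_add exp_diff exp_minus field_simps)

lemma semigroup_0: "cos \<theta> \<ge> 0 \<Longrightarrow> semigroup \<theta> 0 a = a"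
  by (intro ell1_eqI) (simp add: coord_semigroup)

lemma norm_coord_semigroup_le:
  assumes "t \<ge> 0" "cos \<theta> \<ge> 0"
  shows "norm (coord (semigroup \<theta> t a) k) \<le> norm (coord a k)"
proof -
  have "\<mu> \<theta> \<ge> 0"
    using assms by (simp add: \<mu>_def)
  then have "norm (exp (of_real t * eigenvalue \<theta> k)) \<le> 1"
    unfolding norm_exp_eigenvalue using assms by simp
  then show ?thesis
    unfolding coord_semigroup[OF assms] norm_mult by (intro mult_left_le_one_le) auto
qed

lemma norm_semigroup_le:
  assumes "t \<ge> 0" "cos \<theta> \<ge> 0"
  shows "norm (semigroup \<theta> t a) \<le> norm a"
  using norm_ell1_mono[of "semigroup \<theta> t a" 1 a] norm_coord_semigroup_le[OF assms] by simp

text \<open>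
  On \<open>X\<^sub>s\<close> every active mode has \<open>k\<^sup>2 \<ge> 1\<close>, so the slowest decay rate is \<open>\<omega>\<^sup>2 cos \<theta> = \<mu>\<close>.
\<close>

lemma norm_semigroup_Xs_le:
  assumes "t \<ge> 0" "cos \<theta> \<ge> 0" "a \<in> Xs"
  shows "norm (semigroup \<theta> t a) \<le> exp (- (\<mu> \<theta> * t)) * norm a"
proof (rule norm_ell1_mono)
  fix k
  show "norm (coord (semigroup \<theta> t a) k) \<le> exp (- (\<mu> \<theta> * t)) * norm (coord a k)"
  proof (cases "k = 0")
    case True
    then show ?thesis
      using assms by (simp add: coord_semigroup coord_in_Xs)
  next
    case False
    then have "1 \<le> (real_of_int k)\<^sup>2"
      by (metis of_int_1_le_iff of_int_power zero_less_power2 int_one_le_iff_zero_less)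
    moreover have "\<mu> \<theta> * t \<ge> 0"
      using assms by (simp add: \<mu>_def)
    ultimately have "\<mu> \<theta> * t * 1 \<le> \<mu> \<theta> * t * (real_of_int k)\<^sup>2"
      by (intro mult_left_mono)
    then have "norm (exp (of_real t * eigenvalue \<theta> k)) \<le> exp (- (\<mu> \<theta> * t))"
      unfolding norm_exp_eigenvalue by (simp add: mult_ac)
    then show ?thesis
      unfolding coord_semigroup[OF assms(1,2)] norm_mult by (rule mult_right_mono) simp
  qed
qed

lemma semigroup_in_Xs:
  assumes "t \<ge> 0" "cos \<theta> \<ge> 0" "a \<in> Xs"
  shows "semigroup \<theta> t a \<in> Xs"
  using assms by (simp add: Xs_def coord_semigroup)

lemma bounded_linear_semigroup:
  assumes "t \<ge> 0" "cos \<theta> \<ge> 0"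
  shows "bounded_linear (semigroup \<theta> t)"
proof (rule bounded_linear_intro[where K = 1])
  fix a b :: ell1 and r :: real
  show "semigroup \<theta> t (a + b) = semigroup \<theta> t a + semigroup \<theta> t b"
    by (rule ell1_eqI) (simp add: coord_semigroup assms algebra_simps)
  show "semigroup \<theta> t (r *\<^sub>R a) = r *\<^sub>R semigroup \<theta> t a"
    by (rule ell1_eqI) (simp add: coord_semigroup assms)
  show "norm (semigroup \<theta> t a) \<le> norm a * 1"
    using norm_semigroup_le[OF assms] by simp
qed

lemma small_tail:
  assumes "e > 0"
  obtains F where "finite F" "norm a - e < (\<Sum>k\<in>F. norm (coord a k))"
proof -
  have "((\<lambda>k. norm (coord a k)) has_sum norm a) UNIV"
    unfolding norm_ell1_eq using coord_summable has_sum_infsum by blast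
  then have "((\<lambda>F. \<Sum>k\<in>F. norm (coord a k)) \<longlongrightarrow> norm a) (finite_subsets_at_top UNIV)"
    by (simp add: has_sum_def)
  then have "\<forall>\<^sub>F F in finite_subsets_at_top UNIV. norm a - e < (\<Sum>k\<in>F. norm (coord a k))"
    by (rule order_tendstoD) (use assms in simp)
  then show thesis
    using that by (auto simp: eventually_finite_subsets_at_top)
qed

text \<open>
  The semigroup is only strongly continuous: its eigenvalues are unbounded. A finite set of modes
  carries all but \<open>e / 4\<close> of the norm of \<open>a\<close>; these modes move continuously, and the others
  contribute at most twice their norm because the semigroup contracts each coefficient.
\<close>

lemma continuous_on_semigroup_orbit:
  assumes "cos \<theta> \<ge> 0"
  shows "continuous_on {0..} (\<lambda>t. semigroup \<theta> t a)"
proof (rule continuous_on_iff[THEN iffD2], intro ballI allI impI)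
  fix t e :: real assume t: "t \<in> {0..}" and e: "0 < e"
  obtain F where F: "finite F" "norm a - e / 4 < (\<Sum>k\<in>F. norm (coord a k))"
    using small_tail[of "e / 4" a] e by auto
  define h where "h s = (\<Sum>k\<in>F. norm (coord (semigroup \<theta> s a) k - coord (semigroup \<theta> t a) k))" for s
  have "continuous_on {0..} (\<lambda>s. \<Sum>k\<in>F. norm (exp (of_real s * eigenvalue \<theta> k) * coord a k
      - exp (of_real t * eigenvalue \<theta> k) * coord a k))"
    by (intro continuous_intros)
  then have "continuous_on {0..} h"
    by (rule continuous_on_eq) (use t in \<open>simp add: h_def coord_semigroup assms\<close>)
  then obtain d where d: "d > 0" "\<And>s. s \<in> {0..} \<Longrightarrow> dist s t < d \<Longrightarrow> dist (h s) (h t) < e / 2"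
    using t e unfolding continuous_on_iff by (meson half_gt_zero)
  show "\<exists>d>0. \<forall>s\<in>{0..}. dist s t < d \<longrightarrow> dist (semigroup \<theta> s a) (semigroup \<theta> t a) < e"
  proof (intro exI[of _ d] conjI ballI impI d(1))
    fix s :: real assume s: "s \<in> {0..}" "dist s t < d"
    let ?u = "semigroup \<theta> s a - semigroup \<theta> t a"
    have coord_le: "norm (coord (semigroup \<theta> r a) k) \<le> norm (coord a k)" if "r \<ge> 0" for r k
      using norm_coord_semigroup_le[OF that assms] .
    have u_le: "norm (coord ?u k) \<le> 2 * norm (coord a k)" for k
    proof -
      have "norm (coord ?u k) \<le> norm (coord (semigroup \<theta> s a) k) + norm (coord (semigroup \<theta> t a) k)"
        by (simp add: norm_triangle_ineq4)
      also have "\<dots> \<le> 2 * norm (coord a k)"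
        using coord_le[of s k] coord_le[of t k] s t by simp
      finally show ?thesis .
    qed
    have "norm ?u \<le> h s + e / 2"
    proof (rule norm_ell1_leI)
      fix G :: "int set" assume G: "finite G"
      have "(\<Sum>k\<in>G. norm (coord ?u k)) \<le> (\<Sum>k\<in>F \<union> (G - F). norm (coord ?u k))"
        using F G by (intro sum_mono2) auto
      also have "\<dots> = h s + (\<Sum>k\<in>G - F. norm (coord ?u k))"
        using F G by (subst sum.union_disjoint) (auto simp: h_def)
      also have "(\<Sum>k\<in>G - F. norm (coord ?u k)) \<le> 2 * (\<Sum>k\<in>G - F. norm (coord a k))"
        unfolding sum_distrib_left by (rule sum_mono) (rule u_le)
      also have "(\<Sum>k\<in>G - F. norm (coord a k)) \<le> e / 4"
      proof -
        have "(\<Sum>k\<in>G - F. norm (coord a k)) + (\<Sum>k\<in>F. norm (coord a k))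
            = (\<Sum>k\<in>(G - F) \<union> F. norm (coord a k))"
          using F G by (subst sum.union_disjoint) auto
        also have "\<dots> \<le> norm a"
          using F G by (intro sum_norm_coord_le) auto
        finally show ?thesis using F(2) by linarith
      qed
      finally show "(\<Sum>k\<in>G. norm (coord ?u k)) \<le> h s + e / 2" by simp
    qed
    moreover have "h t = 0" by (simp add: h_def)
    moreover have "\<bar>h s - h t\<bar> < e / 2"
      using d(2)[OF s] by (simp add: dist_real_def)
    ultimately show "dist (semigroup \<theta> s a) (semigroup \<theta> t a) < e"
      by (simp add: dist_norm)
  qed
qed

text \<open>
  Joint continuity follows from strong continuity and the uniform bound \<open>1\<close> on the operator norms:
  the change of the vector is transported by a contraction.
\<close>

lemma continuous_on_semigroup:
  assumes "cos \<theta> \<ge> 0" and f: "continuous_on S f" "\<And>p. p \<in> S \<Longrightarrow> f p \<ge> 0" and g: "continuous_on S g"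
  shows "continuous_on S (\<lambda>p. semigroup \<theta> (f p) (g p))"
  unfolding continuous_on_def
proof
  fix p assume p: "p \<in> S"
  let ?F = "at p within S"
  have ev: "\<forall>\<^sub>F q in ?F. q \<in> S"
    unfolding eventually_at_topological by (intro exI[of _ UNIV]) auto
  have "continuous_on S (\<lambda>q. semigroup \<theta> (f q) (g p))"
    by (rule continuous_on_compose2[OF continuous_on_semigroup_orbit[OF assms(1)] f(1)]) (use f(2) in auto)
  then have 1: "((\<lambda>q. semigroup \<theta> (f q) (g p)) \<longlongrightarrow> semigroup \<theta> (f p) (g p)) ?F"
    using p by (simp add: continuous_on_def)
  have "((\<lambda>q. g q - g p) \<longlongrightarrow> 0) ?F"
    using g p by (auto simp: continuous_on_def LIM_zero)
  then have 2: "((\<lambda>q. semigroup \<theta> (f q) (g q - g p)) \<longlongrightarrow> 0) ?F"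
    by (rule Lim_null_comparison[rotated, OF tendsto_norm_zero])
       (use f(2) in \<open>auto intro!: eventually_mono[OF ev] norm_semigroup_le assms(1)\<close>)
  have "((\<lambda>q. semigroup \<theta> (f q) (g p) + semigroup \<theta> (f q) (g q - g p)) \<longlongrightarrow> semigroup \<theta> (f p) (g p) + 0) ?F"
    by (rule tendsto_add[OF 1 2])
  then show "((\<lambda>q. semigroup \<theta> (f q) (g q)) \<longlongrightarrow> semigroup \<theta> (f p) (g p)) ?F"
    unfolding add_0_right
  proof (rule Lim_transform_eventually)
    show "\<forall>\<^sub>F q in ?F. semigroup \<theta> (f q) (g p) + semigroup \<theta> (f q) (g q - g p) = semigroup \<theta> (f q) (g q)"
      using ev
    proof eventually_elim
      case (elim q)
      show ?case
        using linear_add[OF bounded_linear.linear[OF bounded_linear_semigroup[OF f(2)[OF elim] assms(1)]],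
            of "g p" "g q - g p"] by simp
    qed
  qed
qed

section \<open>Mild solutions under a dissipative forcing\<close>

definition duhamel :: "real \<Rightarrow> ell1 \<Rightarrow> (real \<Rightarrow> ell1) \<Rightarrow> real \<Rightarrow> ell1" where
  "duhamel \<theta> \<xi> g t = semigroup \<theta> t \<xi> + integral {0..t} (\<lambda>s. semigroup \<theta> (t - s) (g s))"

lemma continuous_on_duhamel_integrand:
  assumes "cos \<theta> \<ge> 0" "continuous_on {0..} g" "a \<ge> 0" "b \<le> t"
  shows "continuous_on {a..b} (\<lambda>s. semigroup \<theta> (t - s) (g s))"
  by (rule continuous_on_semigroup[OF assms(1)])
     (use assms in \<open>auto intro!: continuous_intros intro: continuous_on_subset\<close>)

text \<open>
  Moves the variable endpoint into the integrand, where continuity in a parameter can be used.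
\<close>

lemma integral_rescale_01:
  fixes f :: "real \<Rightarrow> 'a::banach"
  assumes "t \<ge> 0" "f integrable_on {0..t}"
  shows "integral {0..t} f = t *\<^sub>R integral {0..1} (\<lambda>r. f (t * r))"
proof (cases "t = 0")
  case False
  then have "t > 0" using assms by simp
  then have "((\<lambda>r. f (t * r)) has_integral (integral {0..t} f /\<^sub>R t)) {0..1}"
    using has_integral_affinity'[of f "integral {0..t} f" 0 t t 0] integrable_integral[OF assms(2)]
    by simp
  from integral_unique[OF this] show ?thesis
    using \<open>t > 0\<close> by simp
qed simp

lemma continuous_on_duhamel:
  assumes "cos \<theta> \<ge> 0" "continuous_on {0..} g"
  shows "continuous_on {0..} (duhamel \<theta> \<xi> g)"
proof -
  have "continuous_on ({0..} \<times> {0..1}) (\<lambda>(t, r). semigroup \<theta> (t - t * r) (g (t * r)))"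
    unfolding case_prod_unfold
  proof (rule continuous_on_semigroup[OF assms(1)])
    show "continuous_on ({0..} \<times> {0..1}) (\<lambda>p :: real \<times> real. fst p - fst p * snd p)"
      by (intro continuous_intros)
    show "0 \<le> fst p - fst p * snd p" if "p \<in> {0..} \<times> {0..1}" for p :: "real \<times> real"
      using that mult_left_mono[of "snd p" 1 "fst p"] by auto
    show "continuous_on ({0..} \<times> {0..1}) (\<lambda>p :: real \<times> real. g (fst p * snd p))"
      by (rule continuous_on_compose2[OF assms(2)]) (auto intro!: continuous_intros)
  qed
  then have "continuous_on {0..} (\<lambda>t. integral {0..1} (\<lambda>r. semigroup \<theta> (t - t * r) (g (t * r))))"
    using integral_continuous_on_param[of "{0..}" 0 "1::real"] by simp
  then have "continuous_on {0..} (\<lambda>t. semigroup \<theta> t \<xi>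
      + t *\<^sub>R integral {0..1} (\<lambda>r. semigroup \<theta> (t - t * r) (g (t * r))))"
    by (intro continuous_intros continuous_on_semigroup_orbit assms(1))
  then show ?thesis
  proof (rule continuous_on_eq)
    fix t :: real assume "t \<in> {0..}"
    then show "semigroup \<theta> t \<xi> + t *\<^sub>R integral {0..1} (\<lambda>r. semigroup \<theta> (t - t * r) (g (t * r))) = duhamel \<theta> \<xi> g t"
      unfolding duhamel_def
      by (subst integral_rescale_01[OF _ integrable_continuous_real[OF continuous_on_duhamel_integrand[OF assms]]]) auto
  qed
qed

text \<open>
  The bound is the exact value of \<open>\<integral> exp (- \<mu> (t - s)) C exp (- \<nu> s) ds\<close> over \<open>[0, t]\<close>. It is used
  with \<open>\<nu> = 0\<close> for the contraction estimate and with \<open>\<nu> > 0\<close> for the exponential decay.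
\<close>

lemma norm_duhamel_integral_le:
  assumes "cos \<theta> \<ge> 0" "continuous_on {0..} g" "t \<ge> 0" "\<nu> < \<mu> \<theta>"
    and g: "\<And>s. 0 \<le> s \<Longrightarrow> s \<le> t \<Longrightarrow> g s \<in> Xs \<and> norm (g s) \<le> C * exp (- (\<nu> * s))"
  shows "norm (integral {0..t} (\<lambda>s. semigroup \<theta> (t - s) (g s)))
    \<le> C / (\<mu> \<theta> - \<nu>) * (exp (- (\<nu> * t)) - exp (- (\<mu> \<theta> * t)))"
proof -
  let ?h = "\<lambda>s. exp (- (\<mu> \<theta> * (t - s))) * (C * exp (- (\<nu> * s)))"
  let ?H = "\<lambda>s. C / (\<mu> \<theta> - \<nu>) * (exp (- (\<mu> \<theta> * (t - s))) * exp (- (\<nu> * s)))"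
  have "(?h has_integral (?H t - ?H 0)) {0..t}"
  proof (rule fundamental_theorem_of_calculus[OF assms(3)])
    fix s assume "s \<in> {0..t}"
    have "((\<lambda>s. exp (- (\<mu> \<theta> * (t - s))) * exp (- (\<nu> * s))) has_real_derivative
        (\<mu> \<theta> - \<nu>) * (exp (- (\<mu> \<theta> * (t - s))) * exp (- (\<nu> * s)))) (at s within {0..t})"
      by (auto intro!: derivative_eq_intros simp: algebra_simps)
    from DERIV_cmult[OF this, of "C / (\<mu> \<theta> - \<nu>)"]
    show "(?H has_vector_derivative ?h s) (at s within {0..t})"
      using assms(4) by (simp add: has_real_derivative_iff_has_vector_derivative[symmetric] mult_ac)
  qed
  moreover have "?H t - ?H 0 = C / (\<mu> \<theta> - \<nu>) * (exp (- (\<nu> * t)) - exp (- (\<mu> \<theta> * t)))"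
    by (simp add: algebra_simps)
  ultimately have h: "(?h has_integral C / (\<mu> \<theta> - \<nu>) * (exp (- (\<nu> * t)) - exp (- (\<mu> \<theta> * t)))) {0..t}"
    by simp
  have "norm (integral {0..t} (\<lambda>s. semigroup \<theta> (t - s) (g s))) \<le> integral {0..t} ?h"
  proof (rule integral_norm_bound_integral)
    show "(\<lambda>s. semigroup \<theta> (t - s) (g s)) integrable_on {0..t}"
      by (intro integrable_continuous_real continuous_on_duhamel_integrand assms) auto
    show "?h integrable_on {0..t}" using h by blast
    fix s assume s: "s \<in> {0..t}"
    have "norm (semigroup \<theta> (t - s) (g s)) \<le> exp (- (\<mu> \<theta> * (t - s))) * norm (g s)"
      using s g by (intro norm_semigroup_Xs_le assms) auto
    also have "\<dots> \<le> ?h s"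
      using s g by (intro mult_left_mono) auto
    finally show "norm (semigroup \<theta> (t - s) (g s)) \<le> ?h s" .
  qed
  then show ?thesis using integral_unique[OF h] by simp
qed

lemma duhamel_in_Xs:
  assumes "cos \<theta> \<ge> 0" "continuous_on {0..} g" "t \<ge> 0" "\<xi> \<in> Xs" "\<And>s. 0 \<le> s \<Longrightarrow> g s \<in> Xs"
  shows "duhamel \<theta> \<xi> g t \<in> Xs"
proof -
  have int: "(\<lambda>s. semigroup \<theta> (t - s) (g s)) integrable_on {0..t}"
    by (intro integrable_continuous_real continuous_on_duhamel_integrand assms) auto
  have "coord (integral {0..t} (\<lambda>s. semigroup \<theta> (t - s) (g s))) 0
      = integral {0..t} (\<lambda>s. coord (semigroup \<theta> (t - s) (g s)) 0)"
    using integral_linear[OF int bounded_linear_coord[of 0]] by (simp add: o_def)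
  also have "\<dots> = integral {0..t} (\<lambda>s. 0)"
    by (rule integral_cong) (use assms in \<open>simp add: coord_in_Xs[OF semigroup_in_Xs]\<close>)
  finally show ?thesis
    using assms by (simp add: Xs_def duhamel_def coord_semigroup)
qed

text \<open>
  The forcing \<open>G\<close> is weaker than the linear damping in two respects: its size is at most \<open>p < \<mu>\<close>
  times the norm of the state, which keeps mild solutions in the ball and makes them decay, and its
  Lipschitz constant \<open>q\<close> is below \<open>\<mu>\<close>, which makes the Duhamel map a contraction in the
  unweighted supremum norm on the whole half-line. Continuity is demanded along curves in the ball
  because \<open>G\<close> is meaningful only there.
\<close>

locale dissipative_forcing =
  fixes \<theta> r p q :: real and G :: "real \<Rightarrow> ell1 \<Rightarrow> ell1"
  assumes p: "0 < p" "p < \<mu> \<theta>" and q: "0 \<le> q" "q < \<mu> \<theta>"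
    and G_cont: "\<And>x. continuous_on {0..} x \<Longrightarrow> (\<And>t. t \<ge> 0 \<Longrightarrow> x t \<in> Bs r)
      \<Longrightarrow> continuous_on {0..} (\<lambda>t. G t (x t))"
    and G_Xs: "\<And>t x. t \<ge> 0 \<Longrightarrow> x \<in> Bs r \<Longrightarrow> G t x \<in> Xs"
    and G_bound: "\<And>t x. t \<ge> 0 \<Longrightarrow> x \<in> Bs r \<Longrightarrow> norm (G t x) \<le> p * norm x"
    and G_lipschitz: "\<And>t x x'. t \<ge> 0 \<Longrightarrow> x \<in> Bs r \<Longrightarrow> x' \<in> Bs r
      \<Longrightarrow> norm (G t x - G t x') \<le> q * norm (x - x')"
begin

lemma mu_pos: "\<mu> \<theta> > 0" and cos_nonneg: "cos \<theta> \<ge> 0"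
proof -
  show "\<mu> \<theta> > 0" using p by simp
  then show "cos \<theta> \<ge> 0" by (simp add: mu_pos_iff_cos)
qed

text \<open>
  The decay class \<open>\<parallel>x t\<parallel> \<le> r exp (- \<nu> t)\<close> is invariant under the Duhamel map. As \<open>p \<le> \<mu> - \<nu>\<close>, the
  forcing contributes at most \<open>r (exp (- \<nu> t) - exp (- \<mu> t))\<close>, which is exactly what the free
  evolution \<open>r exp (- \<mu> t)\<close> leaves over.
\<close>

lemma norm_duhamel_le:
  assumes x: "continuous_on {0..} x" "\<And>t. t \<ge> 0 \<Longrightarrow> x t \<in> Bs r"
      "\<And>t. t \<ge> 0 \<Longrightarrow> norm (x t) \<le> r * exp (- (\<nu> * t))"
    and \<xi>: "\<xi> \<in> Bs r" and \<nu>: "\<nu> \<le> \<mu> \<theta> - p" and t: "t \<ge> 0"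
  shows "norm (duhamel \<theta> \<xi> (\<lambda>s. G s (x s)) t) \<le> r * exp (- (\<nu> * t))"
proof (cases "\<nu> * t \<le> \<mu> \<theta> * t")
  case True
  have r: "r \<ge> 0"
    using \<xi> order_trans[OF norm_ge_zero, of \<xi> r] by (simp add: Bs_def)
  have G: "G s (x s) \<in> Xs \<and> norm (G s (x s)) \<le> p * r * exp (- (\<nu> * s))" if "0 \<le> s" for s
    using G_Xs[OF that x(2)[OF that]]
      order_trans[OF G_bound[OF that x(2)[OF that]] mult_left_mono[OF x(3)[OF that] less_imp_le[OF p(1)]]]
    by (simp add: mult.assoc)
  let ?d = "exp (- (\<nu> * t)) - exp (- (\<mu> \<theta> * t))"
  have "norm (duhamel \<theta> \<xi> (\<lambda>s. G s (x s)) t) \<le> exp (- (\<mu> \<theta> * t)) * norm \<xi> + p * r / (\<mu> \<theta> - \<nu>) * ?d"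
    unfolding duhamel_def
    by (intro norm_triangle_le add_mono norm_semigroup_Xs_le norm_duhamel_integral_le)
       (use G x p \<nu> \<xi> t cos_nonneg in \<open>auto simp: Bs_def intro!: G_cont\<close>)
  also have "\<dots> \<le> exp (- (\<mu> \<theta> * t)) * r + r * ?d"
  proof (intro add_mono mult_left_mono mult_right_mono)
    have "p * r \<le> (\<mu> \<theta> - \<nu>) * r"
      using \<nu> r by (intro mult_right_mono) auto
    then show "p * r / (\<mu> \<theta> - \<nu>) \<le> r"
      using \<nu> p by (simp add: field_simps)
  qed (use \<xi> True in \<open>auto simp: Bs_def\<close>)
  finally show ?thesis by (simp add: algebra_simps)
next
  case False
  \<comment> \<open>Impossible, since \<open>\<nu> < \<mu>\<close>.\<close>
  then show ?thesis
    using \<nu> p t mult_right_mono[of \<nu> "\<mu> \<theta>" t] by simp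
qed

text \<open>
  The factor is \<open>q \<integral> exp (- \<mu> s) ds \<le> q / \<mu>\<close>, uniformly in time.
\<close>

lemma duhamel_contraction:
  assumes x: "continuous_on {0..} x" "\<And>t. t \<ge> 0 \<Longrightarrow> x t \<in> Bs r"
    and y: "continuous_on {0..} y" "\<And>t. t \<ge> 0 \<Longrightarrow> y t \<in> Bs r"
    and D: "\<And>t. t \<ge> 0 \<Longrightarrow> norm (x t - y t) \<le> D" and t: "t \<ge> 0"
  shows "norm (duhamel \<theta> \<xi> (\<lambda>s. G s (x s)) t - duhamel \<theta> \<xi> (\<lambda>s. G s (y s)) t) \<le> q / \<mu> \<theta> * D"
proof -
  let ?g = "\<lambda>s. G s (x s) - G s (y s)"
  have cont: "continuous_on {0..} (\<lambda>s. G s (x s))" "continuous_on {0..} (\<lambda>s. G s (y s))"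
    using x y by (auto intro!: G_cont)
  have int: "(\<lambda>s. semigroup \<theta> (t - s) (G s (x s))) integrable_on {0..t}"
      "(\<lambda>s. semigroup \<theta> (t - s) (G s (y s))) integrable_on {0..t}"
    by (intro integrable_continuous_real continuous_on_duhamel_integrand cont cos_nonneg; simp)+
  have "duhamel \<theta> \<xi> (\<lambda>s. G s (x s)) t - duhamel \<theta> \<xi> (\<lambda>s. G s (y s)) t
      = integral {0..t} (\<lambda>s. semigroup \<theta> (t - s) (G s (x s)) - semigroup \<theta> (t - s) (G s (y s)))"
    by (simp add: duhamel_def integral_diff[OF int])
  also have "\<dots> = integral {0..t} (\<lambda>s. semigroup \<theta> (t - s) (?g s))"
    by (rule integral_cong)
       (simp add: linear_diff[OF bounded_linear.linear[OF bounded_linear_semigroup]] cos_nonneg)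
  also have "norm \<dots> \<le> (q * D) / (\<mu> \<theta> - 0) * (exp (- (0 * t)) - exp (- (\<mu> \<theta> * t)))"
  proof (rule norm_duhamel_integral_le[OF cos_nonneg _ t mu_pos])
    show "continuous_on {0..} ?g" by (intro continuous_intros cont)
    fix s :: real assume "0 \<le> s"
    then show "?g s \<in> Xs \<and> norm (?g s) \<le> q * D * exp (- (0 * s))"
      using G_Xs[of s] x(2)[of s] y(2)[of s] order_trans[OF G_lipschitz mult_left_mono[OF D], of s] q
      by (simp add: Xs_def)
  qed
  also have "\<dots> \<le> q * D / \<mu> \<theta> * 1"
  proof -
    have "D \<ge> 0" using D[OF t] norm_ge_zero order_trans by blast
    then show ?thesis using q mu_pos t by (intro mult_mono) auto
  qed
  finally show ?thesis by simp
qed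

lemma duhamel_fixed_point_unique:
  assumes x: "continuous_on {0..} x" "\<And>t. t \<ge> 0 \<Longrightarrow> x t \<in> Bs r"
      "\<And>t. t \<ge> 0 \<Longrightarrow> x t = duhamel \<theta> \<xi> (\<lambda>s. G s (x s)) t"
    and y: "continuous_on {0..} y" "\<And>t. t \<ge> 0 \<Longrightarrow> y t \<in> Bs r"
      "\<And>t. t \<ge> 0 \<Longrightarrow> y t = duhamel \<theta> \<xi> (\<lambda>s. G s (y s)) t"
    and t: "t \<ge> 0"
  shows "x t = y t"
proof -
  \<comment> \<open>The contraction estimate improves any uniform bound on the difference by the factor \<open>q / \<mu>\<close>.\<close>
  have iterate: "norm (x t - y t) \<le> (q / \<mu> \<theta>) ^ n * (2 * r)" if "t \<ge> 0" for n t
    using that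
  proof (induction n arbitrary: t)
    case 0
    then show ?case
      using norm_triangle_ineq4[of "x t" "y t"] x(2) y(2) by (force simp: Bs_def)
  next
    case (Suc n)
    then have "norm (x t - y t) \<le> q / \<mu> \<theta> * ((q / \<mu> \<theta>) ^ n * (2 * r))"
      using duhamel_contraction[OF x(1,2) y(1,2) Suc.IH, of t \<xi>] x(3) y(3) by simp
    then show ?case by simp
  qed
  have "(\<lambda>n. (q / \<mu> \<theta>) ^ n * (2 * r)) \<longlonglongrightarrow> 0 * (2 * r)"
    by (intro tendsto_mult tendsto_const LIMSEQ_realpow_zero) (use q mu_pos in auto)
  then have "norm (x t - y t) \<le> 0 * (2 * r)"
    by (rule LIMSEQ_le_const) (use iterate[OF t] in blast)
  then show ?thesis by simp
qed

text \<open>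
  Banach's theorem in the space of bounded continuous curves, applied to the closed set of curves
  that take values in \<open>X\<^sub>s\<close> and have the prescribed decay. That space consists of curves on the whole
  line, so time is cut off by \<open>max 0\<close>.
\<close>

lemma duhamel_fixed_point_exists:
  assumes \<xi>: "\<xi> \<in> Bs r" and \<nu>: "0 \<le> \<nu>" "\<nu> \<le> \<mu> \<theta> - p"
  shows "\<exists>x. continuous_on {0..} x \<and> (\<forall>t\<ge>0. x t \<in> Bs r) \<and> (\<forall>t\<ge>0. norm (x t) \<le> r * exp (- (\<nu> * t)))
    \<and> (\<forall>t\<ge>0. x t = duhamel \<theta> \<xi> (\<lambda>s. G s (x s)) t)"
proof -
  have r: "r \<ge> 0"
    using \<xi> order_trans[OF norm_ge_zero, of \<xi> r] by (simp add: Bs_def)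
  define W where "W t = Xs \<inter> cball 0 (r * exp (- (\<nu> * max 0 t)))" for t
  define T where "T x = (\<lambda>t. duhamel \<theta> \<xi> (\<lambda>s. G s (apply_bcontfun x s)) (max 0 t))" for x
  let ?S = "PiC UNIV W :: (real \<Rightarrow>\<^sub>C ell1) set"
  have decay_le: "r * exp (- (\<nu> * max 0 t)) \<le> r" for t
    using r \<nu>(1) by (intro mult_left_le) auto
  have closed_Xs: "closed Xs"
    unfolding Xs_def by (intro closed_Collect_eq continuous_intros)
  have complete: "complete ?S"
    unfolding complete_eq_closed by (rule closed_PiC) (auto simp: W_def closed_Int closed_Xs)
  have zero: "0 \<in> Xs"
    by (simp add: Xs_def)
  then have nonempty: "const_bcontfun 0 \<in> ?S"
    using r by (auto simp: mem_PiC_iff W_def)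
  have S: "apply_bcontfun x t \<in> Bs r" "norm (apply_bcontfun x t) \<le> r * exp (- (\<nu> * max 0 t))" if "x \<in> ?S" for x t
    using that decay_le[of t] unfolding mem_PiC_iff by (auto simp: W_def Bs_def Pi_iff intro: order_trans)
  have T_W: "T x t \<in> W t" if "x \<in> ?S" for x t
  proof -
    have "T x t \<in> Xs"
      unfolding T_def using S(1)[OF that] \<xi>
      by (intro duhamel_in_Xs cos_nonneg G_cont G_Xs) (auto simp: Bs_def)
    moreover have "norm (T x t) \<le> r * exp (- (\<nu> * max 0 t))"
      unfolding T_def using S[OF that] \<nu>(2) \<xi>
      by (intro norm_duhamel_le) (auto, metis max.absorb2)
    ultimately show ?thesis by (simp add: W_def)
  qed
  have T_bcontfun: "T x \<in> bcontfun" if "x \<in> ?S" for x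
  proof (rule bcontfun_normI)
    have "continuous_on {0..} (duhamel \<theta> \<xi> (\<lambda>s. G s (apply_bcontfun x s)))"
      using S(1)[OF that] by (intro continuous_on_duhamel cos_nonneg G_cont) auto
    then show "continuous_on UNIV (T x)"
      unfolding T_def by (rule continuous_on_compose2) (auto intro!: continuous_intros)
    show "norm (T x t) \<le> r" for t
      using T_W[OF that, of t] decay_le[of t] by (simp add: W_def)
  qed
  have "\<exists>!x\<in>?S. Bcontfun (T x) = x"
  proof (rule Banach_fix[OF complete])
    show "?S \<noteq> {}" using nonempty by blast
    show "0 \<le> q / \<mu> \<theta>" "q / \<mu> \<theta> < 1" using q mu_pos by auto
    show "(\<lambda>x. Bcontfun (T x)) ` ?S \<subseteq> ?S"
      using T_W by (auto simp: mem_PiC_iff Bcontfun_inverse[OF T_bcontfun])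
    fix x y assume x: "x \<in> ?S" and y: "y \<in> ?S"
    show "dist (Bcontfun (T x)) (Bcontfun (T y)) \<le> q / \<mu> \<theta> * dist x y"
    proof (rule dist_bound)
      fix t
      have "norm (T x t - T y t) \<le> q / \<mu> \<theta> * dist x y"
        unfolding T_def using S(1)[OF x] S(1)[OF y] dist_bounded[of x _ y]
        by (intro duhamel_contraction) (auto simp: dist_norm)
      then show "dist (apply_bcontfun (Bcontfun (T x)) t) (apply_bcontfun (Bcontfun (T y)) t) \<le> q / \<mu> \<theta> * dist x y"
        by (simp add: Bcontfun_inverse T_bcontfun x y dist_norm)
    qed
  qed
  then obtain x where x: "x \<in> ?S" "Bcontfun (T x) = x" by blast
  show ?thesis
  proof (intro exI[of _ "apply_bcontfun x"] conjI allI impI)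
    show "continuous_on {0..} (apply_bcontfun x)" by simp
    fix t :: real assume t: "t \<ge> 0"
    show "apply_bcontfun x t \<in> Bs r" "norm (apply_bcontfun x t) \<le> r * exp (- (\<nu> * t))"
      using S[OF x(1), of t] t by (simp_all add: max_absorb2)
    have "apply_bcontfun x t = T x t"
      using x(2) Bcontfun_inverse[OF T_bcontfun[OF x(1)]] by simp
    then show "apply_bcontfun x t = duhamel \<theta> \<xi> (\<lambda>s. G s (apply_bcontfun x s)) t"
      using t by (simp add: T_def max_absorb2)
  qed
qed

end

section \<open>Variation of constants and uniqueness for the full equation\<close>

lemma duhamel_0: "cos \<theta> \<ge> 0 \<Longrightarrow> duhamel \<theta> \<xi> g 0 = \<xi>"
  by (simp add: duhamel_def semigroup_0)

text \<open>
  Restarting at time \<open>t\<close>: the integral up to \<open>t\<close> is propagated by the semigroup, the rest is shifted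
  to start at \<open>0\<close>. This is the flow property of mild solutions.
\<close>

lemma duhamel_add:
  assumes "cos \<theta> \<ge> 0" "continuous_on {0..} g" "s \<ge> 0" "t \<ge> 0"
  shows "duhamel \<theta> \<xi> g (t + s) = duhamel \<theta> (duhamel \<theta> \<xi> g t) (\<lambda>u. g (t + u)) s"
proof -
  let ?f = "\<lambda>r u. semigroup \<theta> (r - u) (g u)"
  note lin = bounded_linear_semigroup[OF assms(3,1)]
  have int: "?f r integrable_on {a..b}" if "0 \<le> a" "b \<le> r" for a b r
    using assms that by (intro integrable_continuous_real continuous_on_duhamel_integrand) auto
  have "integral {0..t + s} (?f (t + s)) = integral {0..t} (?f (t + s)) + integral {t..t + s} (?f (t + s))"
    using assms by (intro Henstock_Kurzweil_Integration.integral_combine[symmetric] int) auto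
  also have "integral {0..t} (?f (t + s)) = integral {0..t} (\<lambda>u. semigroup \<theta> s (?f t u))"
  proof (rule integral_cong)
    fix u assume "u \<in> {0..t}"
    then show "?f (t + s) u = semigroup \<theta> s (?f t u)"
      using semigroup_add[of s "t - u" \<theta> "g u"] assms by (simp add: algebra_simps)
  qed
  also have "\<dots> = semigroup \<theta> s (integral {0..t} (?f t))"
    using integral_linear[OF int[of 0 t t] lin] by (simp add: o_def)
  also have "integral {t..t + s} (?f (t + s)) = integral {0..s} (\<lambda>u. semigroup \<theta> (s - u) (g (t + u)))"
    using integral_shift_Icc_real[of 0 s "?f (t + s)" t] by (simp add: o_def add.commute)
  finally show ?thesis
    using semigroup_add[of s t \<theta> \<xi>] assms
    by (simp add: duhamel_def linear_add[OF bounded_linear.linear[OF lin]] add.commute)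
qed

lemma integral_has_vector_derivative_atLeast:
  fixes f :: "real \<Rightarrow> 'a::banach"
  assumes "continuous_on {0..} f" "t \<ge> 0"
  shows "((\<lambda>t. integral {0..t} f) has_vector_derivative f t) (at t within {0..})"
proof -
  have "((\<lambda>t. integral {0..t} f) has_vector_derivative f t) (at t within {0..t + 1})"
    using assms by (intro integral_has_vector_derivative) (auto intro: continuous_on_subset)
  moreover have "at t within {0..t + 1} = at t within {0..}"
    by (rule at_within_nhd[of _ "{..<t + 1}"]) auto
  ultimately show ?thesis by simp
qed

lemma has_vector_derivative_exp_of_real:
  "((\<lambda>t. exp (of_real t * c)) has_vector_derivative c * exp (of_real t * c)) (at t within S)"
  for c :: complex
  using exp_scaleR_has_vector_derivative_right[of c t S] by (simp add: scaleR_conv_of_real mult.commute)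

text \<open>
  Coefficientwise the generator is bounded, so a mild solution satisfies the equation of each Fourier
  coefficient classically although it need not be differentiable in \<open>\<ell>\<^sup>1\<close>.
\<close>

lemma coord_duhamel_has_vector_derivative:
  assumes "cos \<theta> \<ge> 0" "continuous_on {0..} g" "t \<ge> 0"
  shows "((\<lambda>t. coord (duhamel \<theta> \<xi> g t) k) has_vector_derivative
    eigenvalue \<theta> k * coord (duhamel \<theta> \<xi> g t) k + coord (g t) k) (at t within {0..})"
proof -
  define c where "c = eigenvalue \<theta> k"
  define I where "I t = integral {0..t} (\<lambda>s. exp (- (of_real s * c)) * coord (g s) k)" for t
  have coord_eq: "coord (duhamel \<theta> \<xi> g t) k = exp (of_real t * c) * (coord \<xi> k + I t)" if "t \<ge> 0" for t
  proof -
    have int: "(\<lambda>s. semigroup \<theta> (t - s) (g s)) integrable_on {0..t}"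
      by (intro integrable_continuous_real continuous_on_duhamel_integrand assms) auto
    have "coord (integral {0..t} (\<lambda>s. semigroup \<theta> (t - s) (g s))) k
        = integral {0..t} (\<lambda>s. coord (semigroup \<theta> (t - s) (g s)) k)"
      using integral_linear[OF int bounded_linear_coord[of k]] by (simp add: o_def)
    also have "\<dots> = integral {0..t} (\<lambda>s. exp (of_real t * c) * (exp (- (of_real s * c)) * coord (g s) k))"
    proof (rule integral_cong)
      fix s assume "s \<in> {0..t}"
      then have "coord (semigroup \<theta> (t - s) (g s)) k = exp (of_real (t - s) * c) * coord (g s) k"
        unfolding c_def using assms by (intro coord_semigroup) auto
      also have "exp (of_real (t - s) * c) = exp (of_real t * c) * exp (- (of_real s * c))"
        by (simp add: left_diff_distrib flip: exp_add)
      finally show "coord (semigroup \<theta> (t - s) (g s)) k = exp (of_real t * c) * (exp (- (of_real s * c)) * coord (g s) k)"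
        by (simp add: mult.assoc)
    qed
    also have "\<dots> = exp (of_real t * c) * I t"
      unfolding I_def by (rule integral_mult_right)
    finally show ?thesis
      using coord_semigroup[OF that assms(1), of \<xi> k]
      by (simp add: duhamel_def c_def distrib_left)
  qed
  have "continuous_on {0..} (\<lambda>s. exp (- (of_real s * c)) * coord (g s) k)"
    using assms by (intro continuous_intros)
  from integral_has_vector_derivative_atLeast[OF this assms(3)]
  have "(I has_vector_derivative exp (- (of_real t * c)) * coord (g t) k) (at t within {0..})"
    by (simp add: I_def[abs_def])
  then have "((\<lambda>t. exp (of_real t * c) * (coord \<xi> k + I t)) has_vector_derivative
      exp (of_real t * c) * (0 + exp (- (of_real t * c)) * coord (g t) k)
        + c * exp (of_real t * c) * (coord \<xi> k + I t)) (at t within {0..})"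
    by (intro has_vector_derivative_mult has_vector_derivative_add has_vector_derivative_const
        has_vector_derivative_exp_of_real)
  moreover have "exp (of_real t * c) * (0 + exp (- (of_real t * c)) * coord (g t) k)
        + c * exp (of_real t * c) * (coord \<xi> k + I t) = c * coord (duhamel \<theta> \<xi> g t) k + coord (g t) k"
    using assms(3) by (simp add: coord_eq exp_minus algebra_simps)
  ultimately have "((\<lambda>t. exp (of_real t * c) * (coord \<xi> k + I t)) has_vector_derivative
      c * coord (duhamel \<theta> \<xi> g t) k + coord (g t) k) (at t within {0..})"
    by simp
  then show ?thesis
    unfolding c_def[symmetric]
    by (rule has_vector_derivative_transform[rotated -1]) (use assms coord_eq in auto)
qed

text \<open>
  Converse to the previous lemma: the difference to the Duhamel curve solves a scalar homogeneous
  linear equation in every coefficient, so its integrating-factor multiple is constant.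
\<close>

lemma variation_of_constants:
  assumes cos: "cos \<theta> \<ge> 0" and g: "continuous_on {0..} g"
    and w: "\<And>t k. t \<ge> 0 \<Longrightarrow> ((\<lambda>t. coord (w t) k) has_vector_derivative
      eigenvalue \<theta> k * coord (w t) k + coord (g t) k) (at t within {0..})"
    and t: "t \<ge> 0"
  shows "w t = duhamel \<theta> (w 0) g t"
proof (rule ell1_eqI)
  fix k
  define c where "c = eigenvalue \<theta> k"
  define u where "u t = coord (w t) k - coord (duhamel \<theta> (w 0) g t) k" for t
  have "((\<lambda>t. exp (of_real t * - c) * u t) has_derivative (\<lambda>h. 0)) (at s within {0..})" if "s \<in> {0..}" for s
  proof -
    have "(u has_vector_derivative c * coord (w s) k + coord (g s) k
        - (c * coord (duhamel \<theta> (w 0) g s) k + coord (g s) k)) (at s within {0..})"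
      unfolding u_def c_def using that
      by (intro has_vector_derivative_diff w coord_duhamel_has_vector_derivative cos g) auto
    then have "(u has_vector_derivative c * u s) (at s within {0..})"
      by (simp add: u_def right_diff_distrib)
    from has_vector_derivative_mult[OF has_vector_derivative_exp_of_real this, of "- c"]
    show ?thesis
      by (simp add: has_vector_derivative_def mult_ac)
  qed
  from has_derivative_zero_unique[OF _ this, of t 0]
  have "exp (of_real t * - c) * u t = u 0"
    using t by simp
  moreover have "u 0 = 0"
    by (simp add: u_def duhamel_0 cos)
  ultimately show "coord (w t) k = coord (duhamel \<theta> (w 0) g t) k"
    by (simp add: u_def)
qed

text \<open>
  By variation of constants the difference \<open>w\<close> of two solutions satisfies
  \<open>\<parallel>w s\<parallel> \<le> L \<integral> \<parallel>w u\<parallel> du\<close> on \<open>[0, t]\<close>, where \<open>L\<close> comes from bounds on both solutions on this compact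
  interval. Weighting with \<open>exp (- 2 L s)\<close> turns this into \<open>max m \<le> max m / 2\<close>.
\<close>

lemma is_solution_unique:
  assumes cos: "cos \<theta> \<ge> 0" and a: "is_solution \<theta> a0 a" and b: "is_solution \<theta> a0 b" and t: "t \<ge> 0"
  shows "b t = a t"
proof -
  interpret cv: bounded_bilinear conv by (rule bounded_bilinear_conv)
  have cont: "continuous_on {0..} a" "continuous_on {0..} b" and init: "a 0 = b 0"
    using a b by (auto simp: is_solution_def)
  define w where "w s = a s - b s" for s
  define g where "g s = cscale (cis \<theta>) (conv (a s) (a s) - conv (b s) (b s))" for s
  have g_cont: "continuous_on {0..} g"
    unfolding g_def by (intro continuous_intros cont)
  have w_cont: "continuous_on {0..} w"
    unfolding w_def by (intro continuous_intros cont)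
  have deriv: "((\<lambda>s. coord (w s) k) has_vector_derivative
      eigenvalue \<theta> k * coord (w s) k + coord (g s) k) (at s within {0..})" if s: "s \<ge> 0" for s k
  proof -
    have "((\<lambda>s. coord (a s) k - coord (b s) k) has_vector_derivative
      cis \<theta> * (- of_real ((real_of_int k)\<^sup>2 * \<omega>\<^sup>2) * coord (a s) k + coord (conv (a s) (a s)) k)
      - cis \<theta> * (- of_real ((real_of_int k)\<^sup>2 * \<omega>\<^sup>2) * coord (b s) k + coord (conv (b s) (b s)) k))
      (at s within {0..})"
      using a b s by (intro has_vector_derivative_diff) (auto simp: is_solution_def)
    moreover have "cis \<theta> * (- of_real ((real_of_int k)\<^sup>2 * \<omega>\<^sup>2) * coord (a s) k + coord (conv (a s) (a s)) k)
      - cis \<theta> * (- of_real ((real_of_int k)\<^sup>2 * \<omega>\<^sup>2) * coord (b s) k + coord (conv (b s) (b s)) k)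
      = eigenvalue \<theta> k * coord (w s) k + coord (g s) k"
      by (simp add: w_def g_def algebra_simps)
    ultimately show ?thesis
      by (simp only: w_def coord_simps)
  qed
  have w_eq: "w s = integral {0..s} (\<lambda>u. semigroup \<theta> (s - u) (g u))" if "s \<ge> 0" for s
  proof -
    have "w s = duhamel \<theta> (w 0) g s"
      by (rule variation_of_constants[OF cos g_cont deriv that])
    moreover have "semigroup \<theta> s 0 = 0"
      by (rule ell1_eqI) (simp add: coord_semigroup[OF that cos])
    ultimately show ?thesis
      by (simp add: duhamel_def w_def init)
  qed
  have "bounded (a ` {0..t})" "bounded (b ` {0..t})"
    by (intro compact_imp_bounded compact_continuous_image continuous_on_subset[OF cont(1)]
        continuous_on_subset[OF cont(2)]; simp)+
  then obtain Ra Rb where R: "\<And>s. s \<in> {0..t} \<Longrightarrow> norm (a s) \<le> Ra" "\<And>s. s \<in> {0..t} \<Longrightarrow> norm (b s) \<le> Rb"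
    unfolding bounded_iff by blast
  \<comment> \<open>The maximum with \<open>1\<close> makes \<open>L\<close> positive, as needed for the weight below.\<close>
  define L where "L = max 1 (Ra + Rb)"
  have L: "L > 0" by (simp add: L_def)
  have g_le: "norm (g s) \<le> L * norm (w s)" if "s \<in> {0..t}" for s
  proof -
    have "g s = cscale (cis \<theta>) (conv (w s) (a s) + conv (b s) (w s))"
      by (simp add: g_def w_def cv.diff_left cv.diff_right)
    then have "norm (g s) \<le> norm (conv (w s) (a s)) + norm (conv (b s) (w s))"
      by (simp add: norm_cscale norm_triangle_ineq)
    also have "\<dots> \<le> norm (w s) * norm (a s) + norm (b s) * norm (w s)"
      by (intro add_mono norm_conv_le)
    also have "\<dots> = (norm (a s) + norm (b s)) * norm (w s)"
      by (simp add: algebra_simps)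
    also have "\<dots> \<le> L * norm (w s)"
      using R[OF that] by (intro mult_right_mono) (auto simp: L_def)
    finally show ?thesis .
  qed
  define m where "m s = exp (- (2 * L * s)) * norm (w s)" for s
  have "continuous_on {0..t} m"
    unfolding m_def by (intro continuous_intros continuous_on_subset[OF w_cont]) auto
  then obtain s where s: "s \<in> {0..t}" and max: "\<And>u. u \<in> {0..t} \<Longrightarrow> m u \<le> m s"
    using continuous_attains_sup[of "{0..t}" m] t by auto
  let ?h = "\<lambda>u. L * m s * exp (2 * L * u)"
  have h: "(?h has_integral (m s / 2 * exp (2 * L * s) - m s / 2 * exp (2 * L * 0))) {0..s}"
    using s L by (intro fundamental_theorem_of_calculus)
       (auto intro!: derivative_eq_intros simp: has_real_derivative_iff_has_vector_derivative[symmetric])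
  have "norm (w s) \<le> integral {0..s} ?h"
    unfolding w_eq[OF s[unfolded atLeastAtMost_iff, THEN conjunct1]]
  proof (rule integral_norm_bound_integral)
    show "(\<lambda>u. semigroup \<theta> (s - u) (g u)) integrable_on {0..s}"
      by (intro integrable_continuous_real continuous_on_duhamel_integrand cos g_cont) auto
    show "?h integrable_on {0..s}" using h by blast
    fix u assume u: "u \<in> {0..s}"
    then have "norm (semigroup \<theta> (s - u) (g u)) \<le> L * norm (w u)"
      using s by (intro order_trans[OF norm_semigroup_le g_le] cos) auto
    also have "norm (w u) = m u * exp (2 * L * u)"
      by (simp add: m_def exp_minus)
    also have "L * (m u * exp (2 * L * u)) \<le> L * (m s * exp (2 * L * u))"
      using L u s max[of u] by (intro mult_left_mono mult_right_mono) auto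
    finally show "norm (semigroup \<theta> (s - u) (g u)) \<le> ?h u"
      by (simp add: mult.assoc)
  qed
  also have "\<dots> \<le> m s / 2 * exp (2 * L * s)"
    unfolding integral_unique[OF h] by (simp add: m_def)
  also have "\<dots> = norm (w s) / 2"
    by (simp add: m_def exp_minus)
  finally have "m s = 0"
    by (simp add: m_def)
  then have "m t \<le> 0"
    using max[of t] t by simp
  then show ?thesis
    by (simp add: m_def w_def mult_le_0_iff)
qed

section \<open>The flow on the centre space\<close>

text \<open>
  With \<open>z = e\<^bsup>i\<theta>\<^esup> \<phi>\<close> the square equals \<open>1 - 2 t Re z + t\<^sup>2 \<bar>z\<bar>\<^sup>2\<close>, and \<open>Re z \<le> 0\<close> on \<open>B\<^sub>c\<close>. This one
  inequality gives global existence of the centre flow, its decay like \<open>1 / t\<close> and the integrability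
  of \<open>\<bar>\<Phi>\<bar>\<^sup>2\<close>.
\<close>

lemma norm_Phi_denominator:
  assumes "Re (cis \<theta> * \<phi>) \<le> 0" "t \<ge> 0"
  shows "1 + (t * norm \<phi>)\<^sup>2 \<le> (norm (1 - \<phi> * of_real t * cis \<theta>))\<^sup>2"
proof -
  define z where "z = cis \<theta> * \<phi>"
  have "norm z = norm \<phi>" by (simp add: z_def norm_mult)
  moreover have den: "1 - \<phi> * of_real t * cis \<theta> = 1 - of_real t * z"
    by (simp add: z_def mult_ac)
  moreover have "(norm (1 - of_real t * z))\<^sup>2 = 1 - 2 * (t * Re z) + t\<^sup>2 * (norm z)\<^sup>2"
    unfolding cmod_power2 by (simp add: power2_eq_square algebra_simps)
  moreover have "t * Re z \<le> 0"
    using assms by (simp add: z_def mult_nonneg_nonpos)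
  ultimately show ?thesis
    unfolding den power_mult_distrib by simp
qed

lemma Phi_denominator_nonzero:
  assumes "Re (cis \<theta> * \<phi>) \<le> 0" "t \<ge> 0"
  shows "1 - \<phi> * of_real t * cis \<theta> \<noteq> 0"
proof
  assume "1 - \<phi> * of_real t * cis \<theta> = 0"
  then show False
    using norm_Phi_denominator[OF assms] zero_le_power2[of "t * norm \<phi>"] by simp
qed

lemma norm_Phi_square_le:
  assumes "Re (cis \<theta> * \<phi>) \<le> 0" "t \<ge> 0"
  shows "(norm (\<Phi> \<theta> t \<phi>))\<^sup>2 \<le> (norm \<phi>)\<^sup>2 / (1 + (t * norm \<phi>)\<^sup>2)"
proof -
  have pos: "0 < 1 + (t * norm \<phi>)\<^sup>2"
    by (simp add: add_pos_nonneg)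
  then have "0 < (norm (1 - \<phi> * of_real t * cis \<theta>))\<^sup>2"
    using norm_Phi_denominator[OF assms] by linarith
  then show ?thesis
    unfolding \<Phi>_def norm_divide power_divide
    by (intro divide_left_mono norm_Phi_denominator assms mult_pos_pos pos zero_le_power2)
qed

lemma Phi_in_Bc:
  assumes "\<phi> \<in> Bc \<theta> rc" "t \<ge> 0"
  shows "\<Phi> \<theta> t \<phi> \<in> Bc \<theta> rc"
proof -
  have \<phi>: "norm \<phi> \<le> rc" "Re (cis \<theta> * \<phi>) \<le> 0"
    using assms by (auto simp: Bc_def)
  have "(norm (\<Phi> \<theta> t \<phi>))\<^sup>2 \<le> (norm \<phi>)\<^sup>2 / 1"
    by (intro order_trans[OF norm_Phi_square_le[OF \<phi>(2) assms(2)]] divide_left_mono)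
       (auto simp: add_pos_nonneg)
  then have "norm (\<Phi> \<theta> t \<phi>) \<le> norm \<phi>"
    by (simp add: power2_le_iff_abs_le)
  moreover have "Re (cis \<theta> * \<Phi> \<theta> t \<phi>) \<le> 0"
  proof -
    define z where "z = cis \<theta> * \<phi>"
    have "cis \<theta> * \<Phi> \<theta> t \<phi> = z / (1 - of_real t * z)"
      by (simp add: \<Phi>_def z_def mult_ac)
    moreover have "Re (z / (1 - of_real t * z)) = (Re z - t * (norm z)\<^sup>2) / (norm (1 - of_real t * z))\<^sup>2"
    proof -
      have "Re (z * cnj (1 - of_real t * z)) = Re z - t * (norm z)\<^sup>2"
        unfolding cmod_power2 by (simp add: power2_eq_square algebra_simps)
      then show ?thesis
        by (subst complex_div_cnj) (simp only: Re_divide_of_real flip: of_real_power)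
    qed
    moreover have "Re z - t * (norm z)\<^sup>2 \<le> 0"
      using \<phi>(2)[folded z_def] mult_nonneg_nonneg[OF assms(2) zero_le_power2[of "norm z"]] by linarith
    ultimately show ?thesis by (simp add: divide_nonpos_nonneg)
  qed
  ultimately show ?thesis using \<phi> by (simp add: Bc_def)
qed

lemma Phi_0: "\<Phi> \<theta> 0 \<phi> = \<phi>"
  by (simp add: \<Phi>_def)

lemma Phi_Phi:
  assumes "Re (cis \<theta> * \<phi>) \<le> 0" "s \<ge> 0" "t \<ge> 0"
  shows "\<Phi> \<theta> s (\<Phi> \<theta> t \<phi>) = \<Phi> \<theta> (t + s) \<phi>"
proof -
  have "1 - \<phi> * of_real t * cis \<theta> \<noteq> 0"
    by (rule Phi_denominator_nonzero[OF assms(1,3)])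
  then show ?thesis
    by (simp add: \<Phi>_def divide_simps) (simp add: algebra_simps)
qed

lemma continuous_on_Phi:
  assumes "Re (cis \<theta> * \<phi>) \<le> 0"
  shows "continuous_on {0..} (\<lambda>t. \<Phi> \<theta> t \<phi>)"
  unfolding \<Phi>_def using Phi_denominator_nonzero[OF assms] by (intro continuous_intros) auto

text \<open>
  The majorant of \<open>\<bar>\<Phi>\<bar>\<^sup>2\<close> has the bounded primitive \<open>c arctan (c t)\<close>, including the case \<open>c = 0\<close>.
\<close>

lemma norm_Phi_square_majorant_integrable:
  "(\<lambda>t. c\<^sup>2 / (1 + (t * c)\<^sup>2)) integrable_on {0..}" if "c \<ge> 0" for c :: real
proof -
  let ?h = "\<lambda>t. c\<^sup>2 / (1 + (t * c)\<^sup>2)"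
  have nz: "1 + (t * c)\<^sup>2 \<noteq> 0" for t
    using zero_le_power2[of "t * c"] by linarith
  have primitive: "integral {0..y} ?h = c * arctan (y * c)" if "y \<ge> 0" for y
  proof -
    have "((\<lambda>t. c * arctan (t * c)) has_vector_derivative ?h t) (at t within {0..y})" for t
    proof -
      have "((\<lambda>t. t * c) has_real_derivative c) (at t within {0..y})"
        using DERIV_cmult_right[OF DERIV_ident, of c] by simp
      from DERIV_cmult[OF DERIV_chain2[OF DERIV_arctan this], of c] show ?thesis
        by (simp add: has_real_derivative_iff_has_vector_derivative[symmetric] power2_eq_square
            divide_inverse mult_ac)
    qed
    then have "(?h has_integral (c * arctan (y * c) - c * arctan (0 * c))) {0..y}"
      using that by (intro fundamental_theorem_of_calculus)
    from integral_unique[OF this] show ?thesis by simp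
  qed
  have "\<exists>l. ((\<lambda>y. c * arctan (y * c)) \<longlongrightarrow> l) at_top"
  proof (cases "c = 0")
    case False
    then have "filterlim (\<lambda>y. y * c) at_top at_top"
      using that by (intro filterlim_at_top_mult_tendsto_pos[OF tendsto_const _ filterlim_ident]) auto
    from filterlim_compose[OF tendsto_arctan_at_top this] show ?thesis
      using tendsto_mult_left by blast
  qed auto
  then obtain l where "((\<lambda>y. c * arctan (y * c)) \<longlongrightarrow> l) at_top" by blast
  then have "((\<lambda>y. integral {0..y} ?h) \<longlongrightarrow> l) at_top"
    by (rule Lim_transform_eventually)
       (auto simp: primitive intro!: eventually_mono[OF eventually_ge_at_top[of 0]])
  then have "(?h has_integral l) {0..}"
    by (rule has_integral_to_inf[rotated])
       (auto intro!: integrable_continuous_real continuous_intros simp: nz)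
  then show ?thesis by blast
qed

lemma Phi_tendsto_0:
  assumes "Re (cis \<theta> * \<phi>) \<le> 0"
  shows "((\<lambda>t. \<Phi> \<theta> t \<phi>) \<longlongrightarrow> 0) at_top"
proof (rule Lim_null_comparison)
  show "((\<lambda>t::real. inverse t) \<longlongrightarrow> 0) at_top"
    by (rule tendsto_inverse_0_at_top[OF filterlim_ident])
  show "\<forall>\<^sub>F t in at_top. norm (\<Phi> \<theta> t \<phi>) \<le> inverse t"
  proof (rule eventually_mono[OF eventually_gt_at_top[of 0]])
    fix t :: real assume t: "0 < t"
    have pos: "0 < 1 + (t * norm \<phi>)\<^sup>2"
      by (simp add: add_pos_nonneg)
    have "(norm (\<Phi> \<theta> t \<phi>))\<^sup>2 \<le> (norm \<phi>)\<^sup>2 / (1 + (t * norm \<phi>)\<^sup>2)"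
      using norm_Phi_square_le[OF assms] t by simp
    also have "\<dots> \<le> (inverse t)\<^sup>2"
    proof (subst pos_divide_le_eq[OF pos])
      have "(inverse t)\<^sup>2 * (1 + (t * norm \<phi>)\<^sup>2) = (inverse t)\<^sup>2 + (inverse t * t * norm \<phi>)\<^sup>2"
        by (simp add: power_mult_distrib distrib_left mult.assoc)
      then show "(norm \<phi>)\<^sup>2 \<le> (inverse t)\<^sup>2 * (1 + (t * norm \<phi>)\<^sup>2)"
        using t by simp
    qed
    finally show "norm (\<Phi> \<theta> t \<phi>) \<le> inverse t"
      by (rule power2_le_imp_le) (use t in simp)
  qed
qed

section \<open>Integrals over the half-line\<close>

text \<open>
  The integral over \<open>[0, \<infinity>)\<close> of a function without a majorant could be the default value \<open>0\<close>; under
  a majorant it is the limit of the integrals over \<open>[0, T]\<close>, to which the calculus on compact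
  intervals applies.
\<close>

lemma improper_integral_dominated:
  fixes f :: "real \<Rightarrow> 'a::banach"
  assumes f: "continuous_on {0..} f" and g: "g integrable_on {0..}"
    and le: "\<And>t. t \<ge> 0 \<Longrightarrow> norm (f t) \<le> g t"
  shows "((\<lambda>T. integral {0..T} f) \<longlongrightarrow> integral {0..} f) at_top"
proof -
  let ?f = "\<lambda>x. if x \<in> {0..} then f x else 0"
  have restrict: "(?f has_integral integral {max 0 a..b} f) {a..b}" for a b
  proof -
    have "(f has_integral integral {max 0 a..b} f) {max 0 a..b}"
      by (intro integrable_integral integrable_continuous_real continuous_on_subset[OF f]) auto
    moreover have "{max 0 a..b} = {0..} \<inter> {a..b}" by auto
    ultimately show ?thesis
      by (simp only: has_integral_restrict_Int)
  qed
  have "f integrable_on {0..}"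
    by (rule integrable_on_all_intervals_integrable_bound[OF _ _ g])
       (use restrict le in \<open>auto simp: has_integral_integrable\<close>)
  then have lim: "(f has_integral integral {0..} f) {0..}"
    by (rule integrable_integral)
  show ?thesis
  proof (rule tendstoI)
    fix e :: real assume "e > 0"
    then obtain B where B: "B > 0" "\<And>a b. ball 0 B \<subseteq> cbox a b \<Longrightarrow>
        norm (integral (cbox a b) ?f - integral {0..} f) < e"
      using lim[unfolded has_integral_alt'[of f]] by meson
    show "\<forall>\<^sub>F T in at_top. dist (integral {0..T} f) (integral {0..} f) < e"
    proof (rule eventually_mono[OF eventually_ge_at_top[of B]])
      fix T assume "T \<ge> B"
      then have "ball 0 B \<subseteq> cbox (- B) T" by (auto simp: dist_real_def)
      from B(2)[OF this] show "dist (integral {0..T} f) (integral {0..} f) < e"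
        using integral_unique[OF restrict[of "- B" T]] B(1) by (simp add: dist_norm max_absorb1)
    qed
  qed
qed

lemma integral_shift_atLeast:
  fixes f :: "real \<Rightarrow> 'a::banach"
  assumes f: "continuous_on {0..} f" and g: "g integrable_on {0..}" "g' integrable_on {0..}"
    and le: "\<And>t. t \<ge> 0 \<Longrightarrow> norm (f t) \<le> g t"
    and le': "\<And>s. s \<ge> 0 \<Longrightarrow> norm (f (t + s)) \<le> g' s"
    and t: "t \<ge> 0"
  shows "integral {0..} (\<lambda>s. f (t + s)) = integral {0..} f - integral {0..t} f"
proof (rule tendsto_unique)
  have "continuous_on {0..} (\<lambda>s. f (t + s))"
    by (rule continuous_on_compose2[OF f]) (use t in \<open>auto intro!: continuous_intros\<close>)
  then show "((\<lambda>T. integral {0..T} (\<lambda>s. f (t + s))) \<longlongrightarrow> integral {0..} (\<lambda>s. f (t + s))) at_top"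
    by (rule improper_integral_dominated[OF _ g(2) le'])
  have "((\<lambda>T. integral {0..t + T} f) \<longlongrightarrow> integral {0..} f) at_top"
    by (rule filterlim_compose[OF improper_integral_dominated[OF f g(1) le]])
       (auto intro!: filterlim_tendsto_add_at_top filterlim_ident)
  then have "((\<lambda>T. integral {0..t + T} f - integral {0..t} f) \<longlongrightarrow> integral {0..} f - integral {0..t} f) at_top"
    by (intro tendsto_diff tendsto_const)
  then show "((\<lambda>T. integral {0..T} (\<lambda>s. f (t + s))) \<longlongrightarrow> integral {0..} f - integral {0..t} f) at_top"
  proof (rule Lim_transform_eventually)
    show "\<forall>\<^sub>F T in at_top. integral {0..t + T} f - integral {0..t} f = integral {0..T} (\<lambda>s. f (t + s))"
    proof (rule eventually_mono[OF eventually_ge_at_top[of 0]])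
      fix T :: real assume "0 \<le> T"
      have "integral {0..t} f + integral {t..t + T} f = integral {0..t + T} f"
        using t \<open>0 \<le> T\<close>
        by (intro Henstock_Kurzweil_Integration.integral_combine integrable_continuous_real
            continuous_on_subset[OF f]) auto
      moreover have "integral {0..T} (\<lambda>s. f (t + s)) = integral {t..t + T} f"
        using integral_shift_Icc_real[of 0 T f t] by (simp add: o_def add.commute)
      ultimately show "integral {0..t + T} f - integral {0..t} f = integral {0..T} (\<lambda>s. f (t + s))"
        by (simp add: algebra_simps)
    qed
  qed
qed simp

section \<open>The stable flow driven by a graph map\<close>

text \<open>
  The two inequalities are what the stable equation needs to be dissipative: since
  \<open>\<bar>\<alpha> \<phi> x\<bar> \<le> r\<^sub>c + \<rho> r\<^sub>s\<close>, the first bounds the size and the second the Lipschitz constant of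
  \<open>x \<mapsto> N\<^sub>s (\<alpha> \<phi> x) x\<close> by a number below \<open>\<mu>\<close>.
\<close>

locale graph_map =
  fixes \<theta> \<rho> rc rs :: real and \<alpha> :: "complex \<Rightarrow> ell1 \<Rightarrow> complex"
  assumes pos: "0 < \<rho>" "0 < rc" "0 < rs"
    and bound_lt_mu: "2 * rc + (1 + 2 * \<rho>) * rs < \<mu> \<theta>"
    and lipschitz_lt_mu: "2 * (rc + 2 * \<rho> * rs + rs) < \<mu> \<theta>"
    and alpha: "\<alpha> \<in> LP_space \<theta> \<rho> rc rs"
begin

definition decay :: real where
  "decay = \<mu> \<theta> - (2 * rc + (1 + 2 * \<rho>) * rs)"

lemma decay_pos: "decay > 0"
  using bound_lt_mu by (simp add: decay_def)

lemma zero_in_Bs: "0 \<in> Bs rs"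
  using pos by (simp add: Bs_def Xs_def)

lemma alpha_0: "\<phi> \<in> Bc \<theta> rc \<Longrightarrow> \<alpha> \<phi> 0 = \<phi>"
  using alpha by (simp add: LP_space_def)

lemma alpha_lipschitz:
  "\<phi> \<in> Bc \<theta> rc \<Longrightarrow> x \<in> Bs rs \<Longrightarrow> x' \<in> Bs rs \<Longrightarrow> norm (\<alpha> \<phi> x - \<alpha> \<phi> x') \<le> \<rho> * norm (x - x')"
  using alpha by (simp add: LP_space_def)

lemma alpha_near_identity:
  "\<phi> \<in> Bc \<theta> rc \<Longrightarrow> x \<in> Bs rs \<Longrightarrow> norm (\<alpha> \<phi> x - \<phi>) \<le> \<rho> * norm x"
  using alpha_lipschitz[of \<phi> x 0] alpha_0[of \<phi>] zero_in_Bs by simp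

lemma norm_alpha_le:
  "\<phi> \<in> Bc \<theta> rc \<Longrightarrow> x \<in> Bs rs \<Longrightarrow> norm (\<alpha> \<phi> x) \<le> norm \<phi> + \<rho> * norm x"
  using alpha_near_identity[of \<phi> x] norm_triangle_sub[of "\<alpha> \<phi> x" \<phi>] by linarith

lemma continuous_on_alpha:
  assumes "continuous_on S f" "continuous_on S g" "\<And>t. t \<in> S \<Longrightarrow> f t \<in> Bc \<theta> rc" "\<And>t. t \<in> S \<Longrightarrow> g t \<in> Bs rs"
  shows "continuous_on S (\<lambda>t. \<alpha> (f t) (g t))"
proof -
  obtain L where "L-lipschitz_on (Bc \<theta> rc \<times> Bs rs) (\<lambda>(xc, xs). \<alpha> xc xs)"
    using alpha by (auto simp: LP_space_def)
  then have "continuous_on (Bc \<theta> rc \<times> Bs rs) (\<lambda>(xc, xs). \<alpha> xc xs)"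
    by (rule lipschitz_on_continuous_on)
  from continuous_on_compose2[OF this continuous_on_Pair[OF assms(1,2)]] show ?thesis
    using assms(3,4) by auto
qed

lemma stable_forcing:
  assumes \<phi>: "\<phi> \<in> Bc \<theta> rc"
  shows "dissipative_forcing \<theta> rs (2 * rc + (1 + 2 * \<rho>) * rs) (2 * (rc + 2 * \<rho> * rs + rs))
    (\<lambda>t x. Ns \<theta> (\<alpha> (\<Phi> \<theta> t \<phi>) x) x)"
proof
  show "0 < 2 * rc + (1 + 2 * \<rho>) * rs" "0 \<le> 2 * (rc + 2 * \<rho> * rs + rs)"
    using pos by (simp_all add: add_pos_pos)
  show "2 * rc + (1 + 2 * \<rho>) * rs < \<mu> \<theta>" "2 * (rc + 2 * \<rho> * rs + rs) < \<mu> \<theta>"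
    by (rule bound_lt_mu lipschitz_lt_mu)+
  have Re: "Re (cis \<theta> * \<phi>) \<le> 0"
    using \<phi> by (simp add: Bc_def)
  show "continuous_on {0..} (\<lambda>t. Ns \<theta> (\<alpha> (\<Phi> \<theta> t \<phi>) (x t)) (x t))"
    if "continuous_on {0..} x" "\<And>t. t \<ge> 0 \<Longrightarrow> x t \<in> Bs rs" for x
    using that \<phi> by (intro continuous_intros continuous_on_alpha continuous_on_Phi Re Phi_in_Bc) auto
  have alpha_le: "norm (\<alpha> (\<Phi> \<theta> t \<phi>) x) \<le> rc + \<rho> * rs" if "t \<ge> 0" "x \<in> Bs rs" for t x
  proof -
    have "norm (\<Phi> \<theta> t \<phi>) \<le> rc" "norm x \<le> rs"
      using Phi_in_Bc[OF \<phi> that(1)] that(2) by (simp_all add: Bc_def Bs_def)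
    moreover from this have "\<rho> * norm x \<le> \<rho> * rs"
      using pos by simp
    ultimately show ?thesis
      using norm_alpha_le[OF Phi_in_Bc[OF \<phi> that(1)] that(2)] by linarith
  qed
  fix t :: real and x assume t: "t \<ge> 0" and x: "x \<in> Bs rs"
  note xs = x[unfolded Bs_def, simplified]
  show "Ns \<theta> (\<alpha> (\<Phi> \<theta> t \<phi>) x) x \<in> Xs" by (rule Ns_in_Xs)
  have "norm (Ns \<theta> (\<alpha> (\<Phi> \<theta> t \<phi>) x) x) \<le> (2 * norm (\<alpha> (\<Phi> \<theta> t \<phi>) x) + norm x) * norm x"
    using xs by (intro norm_Ns_le) simp
  also have "\<dots> \<le> (2 * rc + (1 + 2 * \<rho>) * rs) * norm x"
    using alpha_le[OF t x] xs by (intro mult_right_mono) (auto simp: algebra_simps)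
  finally show "norm (Ns \<theta> (\<alpha> (\<Phi> \<theta> t \<phi>) x) x) \<le> (2 * rc + (1 + 2 * \<rho>) * rs) * norm x" .
  fix x' assume x': "x' \<in> Bs rs"
  note xs' = x'[unfolded Bs_def, simplified]
  let ?y = "\<alpha> (\<Phi> \<theta> t \<phi>) x" and ?y' = "\<alpha> (\<Phi> \<theta> t \<phi>) x'"
  have "norm (Ns \<theta> ?y x - Ns \<theta> ?y' x')
      \<le> (2 * norm ?y + norm x + norm x') * norm (x - x') + 2 * norm (?y - ?y') * norm x'"
    using xs xs' by (intro norm_Ns_diff_le) simp_all
  also have "\<dots> \<le> (2 * (rc + \<rho> * rs) + rs + rs) * norm (x - x') + 2 * (\<rho> * norm (x - x')) * rs"
    using alpha_le[OF t x] alpha_lipschitz[OF Phi_in_Bc[OF \<phi> t] x x'] xs xs' pos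
    by (intro add_mono mult_right_mono mult_mono) auto
  finally show "norm (Ns \<theta> ?y x - Ns \<theta> ?y' x') \<le> 2 * (rc + 2 * \<rho> * rs + rs) * norm (x - x')"
    by (simp add: algebra_simps)
qed

lemma cos_nonneg: "cos \<theta> \<ge> 0"
proof -
  have "0 \<in> Bc \<theta> rc" using pos by (simp add: Bc_def)
  from dissipative_forcing.cos_nonneg[OF stable_forcing[OF this]] show ?thesis .
qed

lemma mild_solution_iff_duhamel:
  assumes \<phi>: "\<phi> \<in> Bc \<theta> rc"
  shows "mild_solution \<theta> rs \<alpha> \<phi> \<xi> x \<longleftrightarrow> continuous_on {0..} x \<and> (\<forall>t\<ge>0. x t \<in> Bs rs)
    \<and> (\<forall>t\<ge>0. x t = duhamel \<theta> \<xi> (\<lambda>s. Ns \<theta> (\<alpha> (\<Phi> \<theta> s \<phi>) (x s)) (x s)) t)"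
proof -
  interpret dissipative_forcing \<theta> rs "2 * rc + (1 + 2 * \<rho>) * rs" "2 * (rc + 2 * \<rho> * rs + rs)"
      "\<lambda>t x. Ns \<theta> (\<alpha> (\<Phi> \<theta> t \<phi>) x) x"
    by (rule stable_forcing[OF \<phi>])
  let ?f = "\<lambda>t s. semigroup \<theta> (t - s) (Ns \<theta> (\<alpha> (\<Phi> \<theta> s \<phi>) (x s)) (x s))"
  have "(?f t has_integral (x t - semigroup \<theta> t \<xi>)) {0..t}
      \<longleftrightarrow> x t = duhamel \<theta> \<xi> (\<lambda>s. Ns \<theta> (\<alpha> (\<Phi> \<theta> s \<phi>) (x s)) (x s)) t"
    if "continuous_on {0..} x" "\<forall>t\<ge>0. x t \<in> Bs rs" for t
  proof -
    have "?f t integrable_on {0..t}"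
      by (intro integrable_continuous_real continuous_on_duhamel_integrand cos_nonneg G_cont)
         (use that in auto)
    then show ?thesis
      by (auto simp: has_integral_iff duhamel_def algebra_simps)
  qed
  then show ?thesis
    unfolding mild_solution_def by blast
qed

lemma mild_solution_unique:
  assumes \<phi>: "\<phi> \<in> Bc \<theta> rc" and x: "mild_solution \<theta> rs \<alpha> \<phi> \<xi> x" "mild_solution \<theta> rs \<alpha> \<phi> \<xi> x'" and t: "t \<ge> 0"
  shows "x t = x' t"
proof -
  interpret dissipative_forcing \<theta> rs "2 * rc + (1 + 2 * \<rho>) * rs" "2 * (rc + 2 * \<rho> * rs + rs)"
      "\<lambda>t x. Ns \<theta> (\<alpha> (\<Phi> \<theta> t \<phi>) x) x"
    by (rule stable_forcing[OF \<phi>])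
  show ?thesis
    by (rule duhamel_fixed_point_unique[of x \<xi> x'])
       (use x t in \<open>unfold mild_solution_iff_duhamel[OF \<phi>], blast+\<close>)
qed

text \<open>
  The flow \<open>xflow\<close> is an arbitrary choice among the mild solutions. Existence holds within the curves
  that decay exponentially, uniqueness within all curves in \<open>B\<^sub>s\<close>, so the chosen one decays too.
\<close>

lemma xflow_mild:
  assumes \<phi>: "\<phi> \<in> Bc \<theta> rc" and \<xi>: "\<xi> \<in> Bs rs"
  shows "mild_solution \<theta> rs \<alpha> \<phi> \<xi> (xflow \<theta> rs \<alpha> \<phi> \<xi>)"
    and "t \<ge> 0 \<Longrightarrow> norm (xflow \<theta> rs \<alpha> \<phi> \<xi> t) \<le> rs * exp (- (decay * t))"
proof -
  interpret dissipative_forcing \<theta> rs "2 * rc + (1 + 2 * \<rho>) * rs" "2 * (rc + 2 * \<rho> * rs + rs)"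
      "\<lambda>t x. Ns \<theta> (\<alpha> (\<Phi> \<theta> t \<phi>) x) x"
    by (rule stable_forcing[OF \<phi>])
  have rate: "0 \<le> decay" "decay \<le> \<mu> \<theta> - (2 * rc + (1 + 2 * \<rho>) * rs)"
    using decay_pos by (simp_all add: decay_def)
  from duhamel_fixed_point_exists[OF \<xi> rate] obtain x where
      x: "continuous_on {0..} x" "\<forall>t\<ge>0. x t \<in> Bs rs"
        "\<forall>t\<ge>0. x t = duhamel \<theta> \<xi> (\<lambda>s. Ns \<theta> (\<alpha> (\<Phi> \<theta> s \<phi>) (x s)) (x s)) t"
      and decay: "\<forall>t\<ge>0. norm (x t) \<le> rs * exp (- (decay * t))"
    by (elim exE conjE)
  have mild: "mild_solution \<theta> rs \<alpha> \<phi> \<xi> x"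
    unfolding mild_solution_iff_duhamel[OF \<phi>] by (intro conjI x)
  show xf: "mild_solution \<theta> rs \<alpha> \<phi> \<xi> (xflow \<theta> rs \<alpha> \<phi> \<xi>)"
    unfolding xflow_def by (rule someI[of "mild_solution \<theta> rs \<alpha> \<phi> \<xi>", OF mild])
  show "norm (xflow \<theta> rs \<alpha> \<phi> \<xi> t) \<le> rs * exp (- (decay * t))" if "t \<ge> 0"
    using decay[rule_format, OF that] unfolding mild_solution_unique[OF \<phi> mild xf that] .
qed

lemma xflow_props:
  assumes \<phi>: "\<phi> \<in> Bc \<theta> rc" and \<xi>: "\<xi> \<in> Bs rs"
  shows "continuous_on {0..} (xflow \<theta> rs \<alpha> \<phi> \<xi>)"
    and "t \<ge> 0 \<Longrightarrow> xflow \<theta> rs \<alpha> \<phi> \<xi> t \<in> Bs rs"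
    and "t \<ge> 0 \<Longrightarrow> xflow \<theta> rs \<alpha> \<phi> \<xi> t = duhamel \<theta> \<xi>
      (\<lambda>s. Ns \<theta> (\<alpha> (\<Phi> \<theta> s \<phi>) (xflow \<theta> rs \<alpha> \<phi> \<xi> s)) (xflow \<theta> rs \<alpha> \<phi> \<xi> s)) t"
  using xflow_mild(1)[OF assms] unfolding mild_solution_iff_duhamel[OF \<phi>] by auto

lemma xflow_xflow:
  assumes \<phi>: "\<phi> \<in> Bc \<theta> rc" and \<xi>: "\<xi> \<in> Bs rs" and t: "t \<ge> 0" and s: "s \<ge> 0"
  shows "xflow \<theta> rs \<alpha> (\<Phi> \<theta> t \<phi>) (xflow \<theta> rs \<alpha> \<phi> \<xi> t) s = xflow \<theta> rs \<alpha> \<phi> \<xi> (t + s)"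
proof (rule mild_solution_unique[OF Phi_in_Bc[OF \<phi> t] xflow_mild(1)[OF Phi_in_Bc[OF \<phi> t]] _ s])
  let ?x = "xflow \<theta> rs \<alpha> \<phi> \<xi>"
  let ?g = "\<lambda>s. Ns \<theta> (\<alpha> (\<Phi> \<theta> s \<phi>) (?x s)) (?x s)"
  note x = xflow_props[OF \<phi> \<xi>]
  show "?x t \<in> Bs rs" by (rule x(2)[OF t])
  have Re: "Re (cis \<theta> * \<phi>) \<le> 0"
    using \<phi> by (simp add: Bc_def)
  have g: "continuous_on {0..} ?g"
    using dissipative_forcing.G_cont[OF stable_forcing[OF \<phi>] x(1,2)] .
  show "mild_solution \<theta> rs \<alpha> (\<Phi> \<theta> t \<phi>) (?x t) (\<lambda>s. ?x (t + s))"
    unfolding mild_solution_iff_duhamel[OF Phi_in_Bc[OF \<phi> t]]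
  proof (intro conjI allI impI)
    show "continuous_on {0..} (\<lambda>s. ?x (t + s))"
      by (rule continuous_on_compose2[OF x(1)]) (use t in \<open>auto intro!: continuous_intros\<close>)
    fix s :: real assume s: "s \<ge> 0"
    show "?x (t + s) \<in> Bs rs" using x(2)[of "t + s"] t s by simp
    have "?x (t + s) = duhamel \<theta> (?x t) (\<lambda>u. ?g (t + u)) s"
      using x(3)[of "t + s"] x(3)[OF t] duhamel_add[OF cos_nonneg g s t, of \<xi>] s t by simp
    also have "\<dots> = duhamel \<theta> (?x t) (\<lambda>u. Ns \<theta> (\<alpha> (\<Phi> \<theta> u (\<Phi> \<theta> t \<phi>)) (?x (t + u))) (?x (t + u))) s"
      unfolding duhamel_def by (intro arg_cong2[of _ _ _ _ "(+)"] refl integral_cong) (simp add: Phi_Phi[OF Re] t)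
    finally show "?x (t + s) = duhamel \<theta> (?x t) (\<lambda>u. Ns \<theta> (\<alpha> (\<Phi> \<theta> u (\<Phi> \<theta> t \<phi>)) (?x (t + u))) (?x (t + u))) s" .
  qed
qed

text \<open>
  The centre component is within \<open>\<rho> \<parallel>x\<parallel>\<close> of \<open>\<Phi>\<close>, and \<open>N\<^sub>c\<close> is quadratic. Hence the slow decay
  \<open>\<bar>\<Phi>\<bar> \<le> 1 / t\<close> suffices for the integrand of the Lyapunov-Perron operator to be absolutely integrable.
\<close>

lemma norm_Nc_xflow_le:
  assumes \<phi>: "\<phi> \<in> Bc \<theta> rc" and \<xi>: "\<xi> \<in> Bs rs" and t: "t \<ge> 0"
  shows "norm (Nc \<theta> (\<alpha> (\<Phi> \<theta> t \<phi>) (xflow \<theta> rs \<alpha> \<phi> \<xi> t)) (xflow \<theta> rs \<alpha> \<phi> \<xi> t))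
    \<le> 2 * ((norm \<phi>)\<^sup>2 / (1 + (t * norm \<phi>)\<^sup>2)) + (2 * \<rho>\<^sup>2 + 1) * rs\<^sup>2 * exp (- (2 * decay) * t)"
proof -
  let ?x = "xflow \<theta> rs \<alpha> \<phi> \<xi> t" and ?y = "\<alpha> (\<Phi> \<theta> t \<phi>) (xflow \<theta> rs \<alpha> \<phi> \<xi> t)"
  have x: "?x \<in> Bs rs" by (rule xflow_props(2)[OF \<phi> \<xi> t])
  have "(norm ?x)\<^sup>2 \<le> (rs * exp (- (decay * t)))\<^sup>2"
    by (intro power_mono xflow_mild(2)[OF \<phi> \<xi> t]) simp
  also have "\<dots> = rs\<^sup>2 * exp (- (2 * decay) * t)"
    by (simp add: power_mult_distrib mult.assoc flip: exp_double)
  finally have x2: "(norm ?x)\<^sup>2 \<le> rs\<^sup>2 * exp (- (2 * decay) * t)" .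
  have "(norm ?y)\<^sup>2 \<le> (norm (\<Phi> \<theta> t \<phi>) + \<rho> * norm ?x)\<^sup>2"
    by (intro power_mono norm_alpha_le Phi_in_Bc \<phi> t x) simp
  also have "\<dots> \<le> 2 * (norm (\<Phi> \<theta> t \<phi>))\<^sup>2 + 2 * (\<rho> * norm ?x)\<^sup>2"
    using zero_le_power2[of "norm (\<Phi> \<theta> t \<phi>) - \<rho> * norm ?x"] by (simp add: power2_sum power2_diff)
  also have "(norm (\<Phi> \<theta> t \<phi>))\<^sup>2 \<le> (norm \<phi>)\<^sup>2 / (1 + (t * norm \<phi>)\<^sup>2)"
    using \<phi> t by (intro norm_Phi_square_le) (simp_all add: Bc_def)
  finally have "(norm ?y)\<^sup>2 + (norm ?x)\<^sup>2
      \<le> 2 * ((norm \<phi>)\<^sup>2 / (1 + (t * norm \<phi>)\<^sup>2)) + (2 * \<rho>\<^sup>2 + 1) * (norm ?x)\<^sup>2"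
    by (simp add: power_mult_distrib distrib_right)
  also have "\<dots> \<le> 2 * ((norm \<phi>)\<^sup>2 / (1 + (t * norm \<phi>)\<^sup>2)) + (2 * \<rho>\<^sup>2 + 1) * (rs\<^sup>2 * exp (- (2 * decay) * t))"
    by (intro add_left_mono mult_left_mono x2) simp
  finally show ?thesis
    using norm_Nc_le[of ?x \<theta> ?y] x by (simp add: Bs_def mult.assoc)
qed

lemma majorant_integrable:
  "(\<lambda>t. 2 * ((norm \<phi>)\<^sup>2 / (1 + (t * norm \<phi>)\<^sup>2)) + (2 * \<rho>\<^sup>2 + 1) * rs\<^sup>2 * exp (- (2 * decay) * t))
    integrable_on {0..}" for \<phi> :: complex
  using decay_pos
  by (intro integrable_add integrable_on_mult_right norm_Phi_square_majorant_integrable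
      integrable_on_exp_minus_to_infinity) auto

end

section \<open>Fixed points of the Lyapunov-Perron operator carry solutions\<close>

locale graph_map_fixed_point = graph_map +
  assumes fixed_point: "\<phi> \<in> Bc \<theta> rc \<Longrightarrow> \<xi> \<in> Bs rs \<Longrightarrow> \<Psi> \<theta> rs \<alpha> \<phi> \<xi> = \<alpha> \<phi> \<xi>"
begin

text \<open>
  The fixed point equation is used at the point \<open>(\<Phi> t \<phi>, x t)\<close> reached at time \<open>t\<close>. By the flow
  properties of \<open>\<Phi>\<close> and \<open>x\<close> it reads \<open>y t = - \<integral> N\<^sub>c (y s) (x s) ds\<close> over \<open>[t, \<infinity>)\<close>; subtracting the same
  identity at time \<open>0\<close> leaves an integral over \<open>[0, t]\<close>.
\<close>

lemma centre_integral_equation: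
  assumes \<phi>: "\<phi> \<in> Bc \<theta> rc" and \<xi>: "\<xi> \<in> Bs rs" and t: "t \<ge> 0"
  defines "x \<equiv> xflow \<theta> rs \<alpha> \<phi> \<xi>"
  defines "y \<equiv> (\<lambda>t. \<alpha> (\<Phi> \<theta> t \<phi>) (x t))"
  shows "y t = y 0 + integral {0..t} (\<lambda>s. Nc \<theta> (y s) (x s))"
proof -
  let ?f = "\<lambda>s. Nc \<theta> (y s) (x s)"
  note x = xflow_props[OF \<phi> \<xi>, folded x_def]
  have Re: "Re (cis \<theta> * \<phi>) \<le> 0"
    using \<phi> by (simp add: Bc_def)
  have f_cont: "continuous_on {0..} ?f"
    unfolding y_def using \<phi> x
    by (intro continuous_intros continuous_on_alpha continuous_on_Phi Re Phi_in_Bc) auto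
  have tail: "y t = - (integral {0..} ?f - integral {0..t} ?f)" if t: "t \<ge> 0" for t
  proof -
    let ?\<phi> = "\<Phi> \<theta> t \<phi>"
    have \<phi>t: "?\<phi> \<in> Bc \<theta> rc" by (rule Phi_in_Bc[OF \<phi> t])
    have f_shift: "Nc \<theta> (\<alpha> (\<Phi> \<theta> s ?\<phi>) (xflow \<theta> rs \<alpha> ?\<phi> (x t) s)) (xflow \<theta> rs \<alpha> ?\<phi> (x t) s) = ?f (t + s)"
      if "s \<ge> 0" for s
      using xflow_xflow[OF \<phi> \<xi> t that] that by (simp add: y_def x_def Phi_Phi[OF Re] t)
    have "y t = \<Psi> \<theta> rs \<alpha> ?\<phi> (x t)"
      using fixed_point[OF \<phi>t x(2)[OF t]] by (simp add: y_def)
    also have "\<dots> = - integral {0..} (\<lambda>s. ?f (t + s))"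
      unfolding \<Psi>_def using f_shift by (intro arg_cong[of _ _ uminus] integral_cong) auto
    also have "integral {0..} (\<lambda>s. ?f (t + s)) = integral {0..} ?f - integral {0..t} ?f"
    proof (rule integral_shift_atLeast[OF f_cont majorant_integrable majorant_integrable _ _ t])
      show "norm (?f s) \<le> 2 * ((norm \<phi>)\<^sup>2 / (1 + (s * norm \<phi>)\<^sup>2)) + (2 * \<rho>\<^sup>2 + 1) * rs\<^sup>2 * exp (- (2 * decay) * s)"
        if "s \<ge> 0" for s
        using norm_Nc_xflow_le[OF \<phi> \<xi> that] by (simp add: y_def x_def)
      show "norm (?f (t + s)) \<le> 2 * ((norm ?\<phi>)\<^sup>2 / (1 + (s * norm ?\<phi>)\<^sup>2)) + (2 * \<rho>\<^sup>2 + 1) * rs\<^sup>2 * exp (- (2 * decay) * s)"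
        if "s \<ge> 0" for s
        using norm_Nc_xflow_le[OF \<phi>t x(2)[OF t] that] unfolding f_shift[OF that] .
    qed
    finally show ?thesis .
  qed
  show ?thesis
    using tail[OF t] tail[of 0] by simp
qed

text \<open>
  The curve \<open>(y, x)\<close> solves both components of the full equation: the centre component by the
  fundamental theorem of calculus, the others because \<open>x\<close> is a mild solution driven by \<open>y\<close>. It tends to
  \<open>0\<close> since \<open>\<bar>y\<bar> \<le> \<bar>\<Phi>\<bar> + \<rho> \<parallel>x\<parallel>\<close>.
\<close>

lemma graph_solution:
  assumes \<phi>: "\<phi> \<in> Bc \<theta> rc" and \<xi>: "\<xi> \<in> Bs rs"
  obtains a where "is_solution \<theta> (join (\<alpha> \<phi> \<xi>) \<xi>) a" "(a \<longlongrightarrow> 0) at_top"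
proof -
  define x where "x = xflow \<theta> rs \<alpha> \<phi> \<xi>"
  define y where "y t = \<alpha> (\<Phi> \<theta> t \<phi>) (x t)" for t
  define a where "a t = join (y t) (x t)" for t
  let ?g = "\<lambda>s. Ns \<theta> (y s) (x s)"
  note x = xflow_props[OF \<phi> \<xi>, folded x_def y_def]
  have Re: "Re (cis \<theta> * \<phi>) \<le> 0"
    using \<phi> by (simp add: Bc_def)
  have y_cont: "continuous_on {0..} y"
    unfolding y_def using \<phi> x by (intro continuous_on_alpha continuous_on_Phi Re Phi_in_Bc) auto
  have y_eq: "y t = y 0 + integral {0..t} (\<lambda>s. Nc \<theta> (y s) (x s))" if "t \<ge> 0" for t
    using centre_integral_equation[OF \<phi> \<xi> that] by (simp add: y_def x_def)
  have "is_solution \<theta> (join (\<alpha> \<phi> \<xi>) \<xi>) a"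
    unfolding is_solution_def
  proof (intro conjI allI impI)
    show "continuous_on {0..} a"
      unfolding a_def by (intro continuous_intros x y_cont)
    have "x 0 = \<xi>"
      using x(3)[of 0] by (simp add: duhamel_0 cos_nonneg)
    then show "a 0 = join (\<alpha> \<phi> \<xi>) \<xi>"
      by (simp add: a_def y_def Phi_0)
    fix t :: real and k assume t: "t \<ge> 0"
    show "((\<lambda>t. coord (a t) k) has_vector_derivative
        cis \<theta> * (- of_real ((real_of_int k)\<^sup>2 * \<omega>\<^sup>2) * coord (a t) k + coord (conv (a t) (a t)) k))
        (at t within {0..})"
    proof (cases "k = 0")
      case True
      have "((\<lambda>t. y 0 + integral {0..t} (\<lambda>s. Nc \<theta> (y s) (x s))) has_vector_derivative
          0 + Nc \<theta> (y t) (x t)) (at t within {0..})"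
        by (intro has_vector_derivative_add has_vector_derivative_const integral_has_vector_derivative_atLeast
            continuous_intros x y_cont t)
      then have "(y has_vector_derivative 0 + Nc \<theta> (y t) (x t)) (at t within {0..})"
        by (rule has_vector_derivative_transform[rotated -1]) (use t in simp, rule y_eq, simp)
      moreover have "(\<lambda>t. coord (a t) k) = y"
        using True by (simp add: a_def fun_eq_iff)
      moreover have "0 + Nc \<theta> (y t) (x t)
          = cis \<theta> * (- of_real ((real_of_int k)\<^sup>2 * \<omega>\<^sup>2) * coord (a t) k + coord (conv (a t) (a t)) k)"
        unfolding True a_def Nc_eq by simp
      ultimately show ?thesis by simp
    next
      case False
      have "((\<lambda>t. coord (duhamel \<theta> \<xi> ?g t) k) has_vector_derivative
          eigenvalue \<theta> k * coord (duhamel \<theta> \<xi> ?g t) k + coord (?g t) k) (at t within {0..})"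
        by (intro coord_duhamel_has_vector_derivative cos_nonneg continuous_intros x y_cont t)
      then have "((\<lambda>t. coord (x t) k) has_vector_derivative
          eigenvalue \<theta> k * coord (duhamel \<theta> \<xi> ?g t) k + coord (?g t) k) (at t within {0..})"
        by (rule has_vector_derivative_transform[rotated -1]) (use t x(3) in auto)
      moreover have "eigenvalue \<theta> k * coord (duhamel \<theta> \<xi> ?g t) k + coord (?g t) k
          = cis \<theta> * (- of_real ((real_of_int k)\<^sup>2 * \<omega>\<^sup>2) * coord (a t) k + coord (conv (a t) (a t)) k)"
        using False x(3)[OF t] by (simp add: a_def Ns_def algebra_simps)
      ultimately show ?thesis
        using False by (simp add: a_def)
    qed
  qed
  moreover have "(a \<longlongrightarrow> 0) at_top"
  proof -
    have "((\<lambda>t. rs * exp (- (decay * t))) \<longlongrightarrow> rs * 0) at_top"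
      by (intro tendsto_mult tendsto_const filterlim_compose[OF exp_at_bot]
          filterlim_uminus_at_bot_at_top[THEN filterlim_compose]
          filterlim_tendsto_pos_mult_at_top[OF tendsto_const decay_pos filterlim_ident])
    then have majorant: "((\<lambda>t. rs * exp (- (decay * t))) \<longlongrightarrow> 0) at_top" by simp
    have x_lim: "(x \<longlongrightarrow> 0) at_top"
      by (rule Lim_null_comparison[OF _ majorant])
         (auto intro!: eventually_mono[OF eventually_ge_at_top[of 0]] xflow_mild(2)[OF \<phi> \<xi>] simp: x_def)
    have "((\<lambda>t. norm (\<Phi> \<theta> t \<phi>) + \<rho> * norm (x t)) \<longlongrightarrow> 0 + \<rho> * 0) at_top"
      by (intro tendsto_add tendsto_mult tendsto_const tendsto_norm_zero Phi_tendsto_0 Re x_lim)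
    then have "((\<lambda>t. norm (\<Phi> \<theta> t \<phi>) + \<rho> * norm (x t)) \<longlongrightarrow> 0) at_top" by simp
    then have "(y \<longlongrightarrow> 0) at_top"
      by (rule Lim_null_comparison[rotated])
         (auto intro!: eventually_mono[OF eventually_ge_at_top[of 0]] norm_alpha_le Phi_in_Bc \<phi> x simp: y_def)
    moreover have "join 0 0 = 0"
      by (rule ell1_eqI) simp
    ultimately show ?thesis
      using tendsto_join[of y 0 at_top x 0] x_lim by (simp add: a_def[abs_def])
  qed
  ultimately show thesis by (rule that)
qed

end

section \<open>The graph map reaches every point of U\<close>

lemma cball_subset_of_less_infdist_frontier:
  fixes x :: "'a::real_normed_vector"
  assumes "x \<in> S" "e < infdist x (frontier S)"
  shows "cball x e \<subseteq> S"
proof (rule ccontr)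
  assume "\<not> cball x e \<subseteq> S"
  then obtain z where z: "z \<in> cball x e" "z \<notin> S" by blast
  have "cball x e \<inter> frontier S \<noteq> {}"
  proof (rule connected_Int_frontier)
    have "x \<in> cball x e" using z(1) by (metis centre_in_cball empty_iff cball_eq_empty not_le)
    then show "cball x e \<inter> S \<noteq> {}" using assms(1) by blast
    show "cball x e - S \<noteq> {}" using z by blast
  qed (rule connected_cball)
  then obtain w where "w \<in> frontier S" "dist x w \<le> e" by auto
  with infdist_le[OF this(1), of x] assms(2) show False by simp
qed

context graph_map
begin

text \<open>
  The map \<open>\<alpha> (\<cdot>, xs)\<close> displaces points by at most \<open>\<rho> \<parallel>xs\<parallel>\<close>, and membership in \<open>U\<close> says that the disc of
  this radius around \<open>xc\<close> lies inside \<open>B\<^sub>c\<close>. Correcting \<open>xc\<close> by the displacement maps this disc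
  to itself, and a fixed point given by Brouwer's theorem is a preimage of \<open>xc\<close>.
\<close>

lemma alpha_hits:
  assumes "(xc, xs) \<in> Uset \<theta> \<rho> rc rs"
  obtains \<phi> where "\<phi> \<in> Bc \<theta> rc" "xs \<in> Bs rs" "\<alpha> \<phi> xs = xc"
proof -
  have xc: "xc \<in> Bc \<theta> rc" and xs: "xs \<in> Bs rs" and dist: "\<rho> * norm xs < infdist xc (frontier (Bc \<theta> rc))"
    using assms by (auto simp: Uset_def)
  let ?B = "cball xc (\<rho> * norm xs)"
  have B: "?B \<subseteq> Bc \<theta> rc" by (rule cball_subset_of_less_infdist_frontier[OF xc dist])
  obtain \<phi> where "\<phi> \<in> ?B" "xc + (\<phi> - \<alpha> \<phi> xs) = \<phi>"
  proof (rule brouwer[of ?B "\<lambda>\<phi>. xc + (\<phi> - \<alpha> \<phi> xs)"])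
    show "?B \<noteq> {}"
      using mult_nonneg_nonneg[of \<rho> "norm xs"] pos by (simp add: not_less)
    show "continuous_on ?B (\<lambda>\<phi>. xc + (\<phi> - \<alpha> \<phi> xs))"
      using B xs by (intro continuous_intros continuous_on_alpha) auto
    show "(\<lambda>\<phi>. xc + (\<phi> - \<alpha> \<phi> xs)) \<in> ?B \<rightarrow> ?B"
      using B alpha_near_identity xs by (auto simp: dist_norm norm_minus_commute)
  qed auto
  then show thesis using that[of \<phi>] B xs by (auto simp: algebra_simps)
qed

end

theorem corollary6p3:
  fixes \<theta> \<rho> r\<^sub>c r\<^sub>s \<delta>1 \<delta>2 \<delta>3 \<delta>4 lam :: real
    and \<alpha> :: "complex \<Rightarrow> ell1 \<Rightarrow> complex"
  assumes theta: "- pi / 2 < \<theta>" "\<theta> < pi / 2"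
    and pos: "\<rho> > 0" "r\<^sub>c > 0" "r\<^sub>s > 0"
    and delta1: "\<delta>1 = 2 * r\<^sub>c + (1 + 2 * \<rho>) * r\<^sub>s"
    and delta2: "\<delta>2 = 2 * r\<^sub>c + 2 * (1 + \<rho>) * r\<^sub>s"
    and delta3: "\<delta>3 = 2 * (\<rho> * (r\<^sub>c + \<rho> * r\<^sub>s) + r\<^sub>s)"
    and delta4: "\<delta>4 = 2 * (r\<^sub>c + 2 * \<rho> * r\<^sub>s + r\<^sub>s)"
    and lam: "lam = 2 * (\<rho> * (r\<^sub>c + \<rho> * r\<^sub>s) + r\<^sub>s) * (2 * r\<^sub>s) / ((\<mu> \<theta> - \<delta>1) * (\<mu> \<theta> - \<delta>4))
                  + 2 * (r\<^sub>c + \<rho> * r\<^sub>s) / (\<mu> \<theta> - \<delta>1)"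
    and "\<delta>1 < \<mu> \<theta>" "\<delta>2 < \<mu> \<theta>" "\<delta>4 < \<mu> \<theta>"
    and "\<delta>3 / (\<mu> \<theta> - \<delta>2) < \<rho>"
    and "lam < 1"
    and alpha: "\<alpha> \<in> LP_space \<theta> \<rho> r\<^sub>c r\<^sub>s"
    and fixed_point: "\<forall>\<phi>\<in>Bc \<theta> r\<^sub>c. \<forall>\<xi>\<in>Bs r\<^sub>s. \<Psi> \<theta> r\<^sub>s \<alpha> \<phi> \<xi> = \<alpha> \<phi> \<xi>"
  shows "Uset \<theta> \<rho> r\<^sub>c r\<^sub>s \<subseteq> {(\<alpha> xc xs, xs) | xc xs. xc \<in> Bc \<theta> r\<^sub>c \<and> xs \<in> Bs r\<^sub>s}
    \<and> (\<forall>(xc, xs)\<in>Uset \<theta> \<rho> r\<^sub>c r\<^sub>s.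
         \<exists>a. is_solution \<theta> (join xc xs) a
           \<and> (\<forall>b. is_solution \<theta> (join xc xs) b \<longrightarrow> (\<forall>t\<ge>0. b t = a t))
           \<and> (a \<longlongrightarrow> 0) at_top)"
proof -
  interpret graph_map_fixed_point \<theta> \<rho> r\<^sub>c r\<^sub>s \<alpha>
    using pos \<open>\<delta>1 < \<mu> \<theta>\<close> \<open>\<delta>4 < \<mu> \<theta>\<close> delta1 delta4 alpha fixed_point by unfold_locales auto
  show ?thesis
  proof (intro conjI subsetI ballI)
    fix u assume u: "u \<in> Uset \<theta> \<rho> r\<^sub>c r\<^sub>s"
    obtain xc xs where u_eq: "u = (xc, xs)" by fastforce
    obtain \<phi> where "\<phi> \<in> Bc \<theta> r\<^sub>c" "xs \<in> Bs r\<^sub>s" "\<alpha> \<phi> xs = xc"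
      using alpha_hits[of xc xs] u u_eq by auto
    then show "u \<in> {(\<alpha> xc xs, xs) | xc xs. xc \<in> Bc \<theta> r\<^sub>c \<and> xs \<in> Bs r\<^sub>s}"
      unfolding u_eq by blast
  next
    fix u assume u: "u \<in> Uset \<theta> \<rho> r\<^sub>c r\<^sub>s"
    obtain xc xs where u_eq: "u = (xc, xs)" by fastforce
    obtain \<phi> where "\<phi> \<in> Bc \<theta> r\<^sub>c" "xs \<in> Bs r\<^sub>s" "\<alpha> \<phi> xs = xc"
      using alpha_hits[of xc xs] u u_eq by auto
    then obtain a where "is_solution \<theta> (join xc xs) a" "(a \<longlongrightarrow> 0) at_top"
      using graph_solution[of \<phi> xs] by auto
    then show "case u of (xc, xs) \<Rightarrow> \<exists>a. is_solution \<theta> (join xc xs) a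
           \<and> (\<forall>b. is_solution \<theta> (join xc xs) b \<longrightarrow> (\<forall>t\<ge>0. b t = a t))
           \<and> (a \<longlongrightarrow> 0) at_top"
      unfolding u_eq case_prod_conv using is_solution_unique[OF cos_nonneg] by blast
  qed
qed

end
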